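(* The group $\mathrm{Aut}(\mathbb{Q}\mathbb{U})$ contains $2^{\aleph_0}$ conjugacy classes of isometries which permute the points of $\mathbb{Q}\mathbb{U}$ in a single cycle (that is, isometries $g$ for which $\langle g\rangle$ is transitive on $\mathbb{Q}\mathbb{U}$). Moreover, representatives of distinct such classes remain non-conjugate in $\mathrm{Aut}(\mathbb{U})$.
   Context: $\mathbb{U}$ denotes the Urysohn space: the complete separable metric space, unique up to isometry, that is homogeneous (any isometry between finite subsets extends to an isometry of $\mathbb{U}$ onto itself) and universal (every complete separable metric space embeds isometrically in it). $\mathbb{Q}\mathbb{U}$ denotes the rational Urysohn space: the countable metric space with rational distances, unique up to isometry, such that for every finite subset $A$ and every function $g:A\to\mathbb{Q}$ with $g(a)\ge 0$ and $|g(a)-g(b)|\le d(a,b)\le g(a)+g(b)$ for all $a,b\in A$, there is a point $z$ of the space with $d(z,a)=g(a)$ for all $a\in A$. Its completion is $\mathbb{U}$, and we regard $\mathbb{Q}\mathbb{U}$ as a dense subset of $\mathbb{U}$ in this way. For a metric space $M$, $\mathrm{Aut}(M)$ is the group of all isometries of $M$ onto itself. Every isometry of $\mathbb{Q}\mathbb{U}$ extends uniquely to $\mathbb{U}$, which makes $\mathrm{Aut}(\mathbb{Q}\mathbb{U})$ a subgroup of $\mathrm{Aut}(\mathbb{U})$. *)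

theory Defs
  imports "HOL-Analysis.Analysis" "HOL-Algebra.Bij" "HOL-Algebra.Generated_Groups"
    "HOL-Library.Equipollence"
begin

section \<open>Isometry groups\<close>

definition isometric_on :: "'a set \<Rightarrow> ('a \<Rightarrow> 'a \<Rightarrow> real) \<Rightarrow> ('b \<Rightarrow> 'b \<Rightarrow> real) \<Rightarrow> ('a \<Rightarrow> 'b) \<Rightarrow> bool"
  where "isometric_on M d e f \<longleftrightarrow> (\<forall>x\<in>M. \<forall>y\<in>M. e (f x) (f y) = d x y)"

text \<open>As in \<^const>\<open>BijGroup\<close>, the elements are functions that are extensional on \<open>M\<close>, and the
  product is composition.\<close>

definition isometry_group :: "'a set \<Rightarrow> ('a \<Rightarrow> 'a \<Rightarrow> real) \<Rightarrow> ('a \<Rightarrow> 'a) monoid"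
  where "isometry_group M d = BijGroup M \<lparr>carrier := {f \<in> Bij M. isometric_on M d d f}\<rparr>"

lemma group_isometry_group: "group (isometry_group M d)"
proof -
  have "subgroup {f \<in> Bij M. isometric_on M d d f} (BijGroup M)"
  proof (rule group.subgroupI[OF group_BijGroup])
    show "{f \<in> Bij M. isometric_on M d d f} \<subseteq> carrier (BijGroup M)"
      by (auto simp: BijGroup_def)
    show "{f \<in> Bij M. isometric_on M d d f} \<noteq> {}"
      using id_Bij[of M] by (force simp: isometric_on_def)
    show "inv\<^bsub>BijGroup M\<^esub> f \<in> {f \<in> Bij M. isometric_on M d d f}"
      if "f \<in> {f \<in> Bij M. isometric_on M d d f}" for f
    proof -
      have f: "f \<in> Bij M" "isometric_on M d d f" using that by auto
      have "f ` M = M" using f(1) by (auto simp: Bij_def bij_betw_def)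
      then have "isometric_on M d d (restrict (inv_into M f) M)"
        using f(2) unfolding isometric_on_def
        by (simp add: f_inv_into_f inv_into_into) (metis f_inv_into_f inv_into_into)
      with f(1) show ?thesis
        by (simp add: inv_BijGroup restrict_inv_into_Bij)
    qed
    show "f \<otimes>\<^bsub>BijGroup M\<^esub> g \<in> {f \<in> Bij M. isometric_on M d d f}"
      if "f \<in> {f \<in> Bij M. isometric_on M d d f}" "g \<in> {f \<in> Bij M. isometric_on M d d f}" for f g
    proof -
      have fg: "f \<in> Bij M" "isometric_on M d d f" "g \<in> Bij M" "isometric_on M d d g"
        using that by auto
      have "g x \<in> M" if "x \<in> M" for x
        using Bij_imp_funcset[OF fg(3)] that by auto
      then have "isometric_on M d d (compose M f g)"
        using fg by (simp add: isometric_on_def compose_def)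
      with fg show ?thesis by (simp add: BijGroup_def compose_Bij)
    qed
  qed
  then show ?thesis
    unfolding isometry_group_def by (rule group.subgroup_imp_group[OF group_BijGroup])
qed


section \<open>The Urysohn space and the rational Urysohn space\<close>

text \<open>In the universality clause it suffices to quantify over spaces carried by sets of reals,
  since a separable metric space has at most continuum many points.\<close>

definition urysohn_space :: "'a set \<Rightarrow> ('a \<Rightarrow> 'a \<Rightarrow> real) \<Rightarrow> bool"
  where "urysohn_space U d \<longleftrightarrow>
    Metric_space U d \<and> Metric_space.mcomplete U d \<and>
    separable_space (Metric_space.mtopology U d) \<and>
    (\<forall>A f. finite A \<and> A \<subseteq> U \<and> f \<in> A \<rightarrow> U \<and> isometric_on A d d f \<longrightarrow>
      (\<exists>F\<in>carrier (isometry_group U d). \<forall>a\<in>A. F a = f a)) \<and>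
    (\<forall>(X :: real set) e.
      Metric_space X e \<and> Metric_space.mcomplete X e \<and>
      separable_space (Metric_space.mtopology X e) \<longrightarrow>
      (\<exists>f \<in> X \<rightarrow> U. isometric_on X e d f))"

definition rational_urysohn_space :: "'a set \<Rightarrow> ('a \<Rightarrow> 'a \<Rightarrow> real) \<Rightarrow> bool"
  where "rational_urysohn_space Q d \<longleftrightarrow>
    Metric_space Q d \<and> countable Q \<and> (\<forall>x\<in>Q. \<forall>y\<in>Q. d x y \<in> \<rat>) \<and>
    (\<forall>A g. finite A \<and> A \<subseteq> Q \<and> (\<forall>a\<in>A. g a \<in> \<rat> \<and> 0 \<le> g a) \<and>
       (\<forall>a\<in>A. \<forall>b\<in>A. \<bar>g a - g b\<bar> \<le> d a b \<and> d a b \<le> g a + g b) \<longrightarrow>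
       (\<exists>z\<in>Q. \<forall>a\<in>A. d z a = g a))"

text \<open>The embedding of the isometry group of a dense subset \<open>Q\<close> into that of \<open>U\<close>; it is
  well defined by \<open>ex1_isometry_extension\<close> below.\<close>

definition isometry_extension ::
    "'a set \<Rightarrow> 'a set \<Rightarrow> ('a \<Rightarrow> 'a \<Rightarrow> real) \<Rightarrow> ('a \<Rightarrow> 'a) \<Rightarrow> ('a \<Rightarrow> 'a)"
  where "isometry_extension U Q d g =
    (THE G. G \<in> carrier (isometry_group U d) \<and> (\<forall>x\<in>Q. G x = g x))"

lemma ex1_isometry_extension:
  assumes "Metric_space U d" "Metric_space.mcomplete U d" "Q \<subseteq> U"
    and dense: "Metric_space.mtopology U d closure_of Q = U"
    and g: "g \<in> carrier (isometry_group Q d)"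
  shows "\<exists>!G. G \<in> carrier (isometry_group U d) \<and> (\<forall>x\<in>Q. G x = g x)"
proof -
  interpret Metric_space U d by fact
  have near: "\<exists>q\<in>Q. d x q < e" if "x \<in> U" "e > 0" for x e
    using that dense by (auto simp: metric_closure_of)
  have agree: "G x = H x"
    if G: "G \<in> U \<rightarrow> U" "isometric_on U d d G" and H: "H \<in> U \<rightarrow> U" "isometric_on U d d H"
      and GH: "\<And>q. q \<in> Q \<Longrightarrow> G q = H q" and x: "x \<in> U" for G H x
  proof (rule ccontr)
    assume ne: "G x \<noteq> H x"
    have mem: "G x \<in> U" "H x \<in> U" using G(1) H(1) x by auto
    then have "d (G x) (H x) / 2 > 0" using ne mdist_pos_less by simp
    then obtain q where q: "q \<in> Q" "d x q < d (G x) (H x) / 2" using near x by blast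
    have qU: "q \<in> U" using q assms(3) by auto
    have "d (G x) (H x) \<le> d (G x) (G q) + d (H x) (H q)"
      using triangle'[OF mem(1) _ mem(2), of "G q"] GH[OF q(1)] G(1) qU
      by (metis Pi_mem)
    also have "\<dots> = 2 * d x q"
      using G(2) H(2) x qU by (simp add: isometric_on_def)
    finally show False using q(2) by linarith
  qed
  have ext: "\<exists>G. G \<in> U \<rightarrow> U \<and> isometric_on U d d G \<and> (\<forall>q\<in>Q. G q = f q)"
    if f: "f \<in> Q \<rightarrow> Q" "isometric_on Q d d f" for f
  proof -
    let ?m = "metric (U, d)"
    have "Lipschitz_continuous_map (submetric ?m Q) ?m f"
      unfolding Lipschitz_continuous_map_def
      using f assms(3) by (auto simp: isometric_on_def Pi_iff intro!: exI[of _ 1])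
    then obtain G where G: "Lipschitz_continuous_map (submetric ?m (mtopology_of ?m closure_of Q)) ?m G"
      and Gf: "\<And>x. x \<in> Q \<Longrightarrow> G x = f x"
      using Lipschitz_continuous_map_extends_to_closure_of[of ?m ?m Q f] assms(2)
      by (auto simp: mcomplete_of_def)
    have "submetric ?m (mtopology_of ?m closure_of Q) = ?m"
      using dense by (metis mspace_metric mtopology_of submetric_mspace)
    with G have "Lipschitz_continuous_map ?m ?m G" by (simp only:)
    then obtain B where GU: "G \<in> U \<rightarrow> U" and B: "B > 0"
        "\<And>x y. x \<in> U \<Longrightarrow> y \<in> U \<Longrightarrow> d (G x) (G y) \<le> B * d x y"
      by (auto simp: Lipschitz_continuous_map_pos)
    have "d (G x) (G y) = d x y" if xy: "x \<in> U" "y \<in> U" for x y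
    proof (rule ccontr)
      assume "d (G x) (G y) \<noteq> d x y"
      define e where "e = \<bar>d (G x) (G y) - d x y\<bar> / (2 * (B + 1))"
      have e: "e > 0" using B(1) \<open>d (G x) (G y) \<noteq> d x y\<close> by (simp add: e_def)
      obtain p q where pq: "p \<in> Q" "q \<in> Q" "d x p < e" "d y q < e" using near e xy by meson
      then have pqU: "p \<in> U" "q \<in> U" using assms(3) by auto
      have GpU: "G x \<in> U" "G y \<in> U" "G p \<in> U" "G q \<in> U" using GU xy pqU by auto
      have eq: "d (G p) (G q) = d p q" using f(2) pq Gf by (simp add: isometric_on_def)
      have 1: "\<bar>d x y - d p q\<bar> \<le> d x p + d y q"
        using triangle[OF xy(1) pqU(1) xy(2)] triangle[OF pqU(1) pqU(2) xy(2)]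
          triangle[OF pqU(1) xy(1) pqU(2)] triangle[OF xy(1) xy(2) pqU(2)]
          commute[of x p] commute[of y q] by linarith
      have 2: "\<bar>d (G x) (G y) - d (G p) (G q)\<bar> \<le> d (G x) (G p) + d (G y) (G q)"
        using triangle[OF GpU(1) GpU(3) GpU(2)] triangle[OF GpU(3) GpU(4) GpU(2)]
          triangle[OF GpU(3) GpU(1) GpU(4)] triangle[OF GpU(1) GpU(2) GpU(4)]
          commute[of "G x" "G p"] commute[of "G y" "G q"] by linarith
      have "d (G x) (G p) + d (G y) (G q) \<le> B * (d x p + d y q)"
        using B(2)[OF xy(1) pqU(1)] B(2)[OF xy(2) pqU(2)] by (simp add: distrib_left)
      with 1 2 eq have "\<bar>d (G x) (G y) - d x y\<bar> \<le> (B + 1) * (d x p + d y q)"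
        by (simp add: distrib_right)
      also have "\<dots> < (B + 1) * (2 * e)"
        using pq B(1) by (intro mult_strict_left_mono) auto
      also have "\<dots> = \<bar>d (G x) (G y) - d x y\<bar>" using B(1) by (simp add: e_def field_simps)
      finally show False by simp
    qed
    with GU Gf show ?thesis by (auto simp: isometric_on_def)
  qed
  have gB: "g \<in> Bij Q" and gi: "isometric_on Q d d g"
    using g by (auto simp: isometry_group_def)
  have gQ: "g ` Q = Q" using gB by (auto simp: Bij_def bij_betw_def)
  let ?h = "inv_into Q g"
  have hQ: "?h \<in> Q \<rightarrow> Q" and gh: "\<And>q. q \<in> Q \<Longrightarrow> g (?h q) = q"
    using gQ inv_into_into[of _ g Q] f_inv_into_f[of _ g Q] by auto
  have hi: "isometric_on Q d d ?h"
    using gi hQ gh unfolding isometric_on_def by (metis Pi_mem)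
  obtain G where G: "G \<in> U \<rightarrow> U" "isometric_on U d d G" "\<forall>q\<in>Q. G q = g q"
    using ext[of g] gi gQ by blast
  obtain H where H: "H \<in> U \<rightarrow> U" "isometric_on U d d H" "\<forall>q\<in>Q. H q = ?h q"
    using ext[OF hQ hi] by blast
  have "(G \<circ> H) x = id x" if "x \<in> U" for x
    by (rule agree) (use G H hQ gh that in \<open>auto simp: isometric_on_def Pi_iff\<close>)
  then have "G ` U = U" using G(1) H(1) by (force simp: image_iff Pi_iff)
  moreover have "inj_on G U"
    using G(2) unfolding isometric_on_def inj_on_def by (metis zero)
  ultimately have "restrict G U \<in> Bij U" by (simp add: Bij_def bij_betw_def)
  then have "restrict G U \<in> carrier (isometry_group U d)"
    using G(2) by (simp add: isometry_group_def isometric_on_def)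
  moreover have "\<forall>x\<in>Q. restrict G U x = g x" using G(3) assms(3) by auto
  moreover have "F = F'" if "F \<in> carrier (isometry_group U d) \<and> (\<forall>x\<in>Q. F x = g x)"
      "F' \<in> carrier (isometry_group U d) \<and> (\<forall>x\<in>Q. F' x = g x)" for F F'
  proof (rule extensionalityI)
    show "F \<in> extensional U" "F' \<in> extensional U"
      using that by (auto simp: isometry_group_def Bij_def)
    show "F x = F' x" if "x \<in> U" for x
      by (rule agree)
        (use \<open>F \<in> _ \<and> _\<close> \<open>F' \<in> _ \<and> _\<close> that in \<open>auto simp: isometry_group_def dest: Bij_imp_funcset\<close>)
  qed
  ultimately show ?thesis by blast
qed


section \<open>Conjugacy and single cycles\<close>

definition conjugacy_class :: "('a, 'b) monoid_scheme \<Rightarrow> 'a \<Rightarrow> 'a set"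
  where "conjugacy_class G g = {x \<otimes>\<^bsub>G\<^esub> g \<otimes>\<^bsub>G\<^esub> inv\<^bsub>G\<^esub> x | x. x \<in> carrier G}"

definition single_cycle :: "'a set \<Rightarrow> ('a \<Rightarrow> 'a \<Rightarrow> real) \<Rightarrow> ('a \<Rightarrow> 'a) \<Rightarrow> bool"
  where "single_cycle M d g \<longleftrightarrow>
    (\<forall>x\<in>M. \<forall>y\<in>M. \<exists>h\<in>generate (isometry_group M d) {g}. h x = y)"

definition single_cycle_classes :: "'a set \<Rightarrow> ('a \<Rightarrow> 'a \<Rightarrow> real) \<Rightarrow> ('a \<Rightarrow> 'a) set set"
  where "single_cycle_classes M d =
    conjugacy_class (isometry_group M d) ` {g \<in> carrier (isometry_group M d). single_cycle M d g}"

end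

theory Submission
  imports Defs
begin

text \<open>
  If \<open>g\<close> permutes the points of \<open>Q\<close> in a single cycle, then \<open>\<phi> n = d x (g\<^sup>n x)\<close> does not depend on
  \<open>x\<close>, and \<open>\<phi>\<close> determines the conjugacy class of \<open>g\<close>. By density the extension of \<open>g\<close> to \<open>U\<close> has the
  same displacement function \<open>\<phi>\<close>, which is invariant under conjugation there as well. There are at
  most continuum many rational-valued \<open>\<phi>\<close>.

  For the lower bound, \<open>Q\<close> is identified with the integers under a translation-invariant metric
  \<open>d m n = \<phi> (m - n)\<close>; the shift then is a single cycle. Such a \<open>\<phi>\<close> is the limit of proper
  rational norms on the integers, each of which agrees with its predecessor on a longer interval and
  realizes one more one-point extension \<open>g\<close> of a finite set \<open>A\<close>. To realize it, extend the norm to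
  \<open>\<int>\<^sup>2\<close> with value \<open>g a\<close> at \<open>(-a, 1)\<close>, and take the quotient norm under \<open>(x, r) \<mapsto> x + r M\<close>. As the
  norm is proper, nothing changes on a given finite set of integers once \<open>M\<close> is large. One free
  binary choice at each stage yields continuum many limits.
\<close>

section \<open>Extending proper norms on the integers\<close>

text \<open>Finiteness of balls is the invariant that makes the quotient step work: only finitely
  many lattice points can compete with a given value.\<close>

definition proper_norm :: "(int \<Rightarrow> rat) \<Rightarrow> bool" where
  "proper_norm \<phi> \<longleftrightarrow> \<phi> 0 = 0 \<and> (\<forall>n. n \<noteq> 0 \<longrightarrow> 0 < \<phi> n) \<and> (\<forall>n. \<phi> (- n) = \<phi> n) \<and>
     (\<forall>m n. \<phi> (m + n) \<le> \<phi> m + \<phi> n) \<and> (\<forall>B. finite {n. \<phi> n \<le> B})"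

text \<open>A Katetov function: the distances of a new point to \<open>A\<close> under the metric
  \<open>\<phi> (a - b)\<close>. Positivity keeps the new point off \<open>A\<close>, and
  nonemptiness makes the \<open>Min\<close> in \<open>path_norm\<close> meaningful.\<close>

definition katetov :: "(int \<Rightarrow> rat) \<Rightarrow> int set \<Rightarrow> (int \<Rightarrow> rat) \<Rightarrow> bool" where
  "katetov \<phi> A g \<longleftrightarrow> finite A \<and> A \<noteq> {} \<and> (\<forall>a\<in>A. 0 < g a) \<and>
     (\<forall>a\<in>A. \<forall>b\<in>A. g a \<le> g b + \<phi> (a - b) \<and> \<phi> (a - b) \<le> g a + g b)"

text \<open>The shortest-path norm on \<open>\<int>\<^sup>2\<close> at \<open>(x, r)\<close>; for \<open>r \<ge> 0\<close> an optimal path uses only the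
  generators \<open>(- a, 1)\<close>, never their inverses.\<close>

primrec path_norm :: "(int \<Rightarrow> rat) \<Rightarrow> int set \<Rightarrow> (int \<Rightarrow> rat) \<Rightarrow> nat \<Rightarrow> int \<Rightarrow> rat" where
  "path_norm \<phi> A g 0 x = \<phi> x"
| "path_norm \<phi> A g (Suc r) x = Min ((\<lambda>a. g a + path_norm \<phi> A g r (x + a)) ` A)"

section \<open>Shortest-path norm on the lattice Z^2\<close>

locale norm_request =
  fixes \<phi> :: "int \<Rightarrow> rat" and A :: "int set" and g :: "int \<Rightarrow> rat"
  assumes norm: "proper_norm \<phi>" and kat: "katetov \<phi> A g"
begin

abbreviation N where "N \<equiv> path_norm \<phi> A g"

lemma norm_zero: "\<phi> 0 = 0" and norm_pos: "n \<noteq> 0 \<Longrightarrow> 0 < \<phi> n" and norm_minus: "\<phi> (- n) = \<phi> n"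
  and norm_add: "\<phi> (m + n) \<le> \<phi> m + \<phi> n" and norm_proper: "finite {n. \<phi> n \<le> B}"
  using norm by (auto simp: proper_norm_def)

lemma fin: "finite A" and ne: "A \<noteq> {}" and g_pos: "a \<in> A \<Longrightarrow> 0 < g a"
  and g_lip: "a \<in> A \<Longrightarrow> b \<in> A \<Longrightarrow> g a \<le> g b + \<phi> (a - b)"
  and g_sum: "a \<in> A \<Longrightarrow> b \<in> A \<Longrightarrow> \<phi> (a - b) \<le> g a + g b"
  using kat by (auto simp: katetov_def)

lemma norm_nonneg: "0 \<le> \<phi> n"
  using norm_zero norm_pos[of n] by (cases "n = 0") auto

lemma N_Suc_le: "a \<in> A \<Longrightarrow> N (Suc r) x \<le> g a + N r (x + a)"
  using fin by simp

lemma N_Suc_attained: "\<exists>a\<in>A. N (Suc r) x = g a + N r (x + a)"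
proof -
  have "Min ((\<lambda>a. g a + N r (x + a)) ` A) \<in> (\<lambda>a. g a + N r (x + a)) ` A"
    using fin ne by (intro Min_in) auto
  then show ?thesis by auto
qed

text \<open>The group is abelian, so a displacement \<open>y\<close> can be carried past all steps
  to the end of a path, where it costs \<open>\<phi> y\<close>.\<close>

lemma N_shift: "N r (x + y) \<le> \<phi> y + N r x"
proof (induction r arbitrary: x)
  case 0
  show ?case using norm_add[of y x] by (simp add: add.commute)
next
  case (Suc r)
  obtain a where a: "a \<in> A" "N (Suc r) x = g a + N r (x + a)"
    using N_Suc_attained by blast
  show ?case
    using N_Suc_le[OF a(1), of r "x + y"] Suc[of "x + a"] a(2) by (simp add: algebra_simps)
qed

text \<open>Concatenation of paths: steps are peeled off an optimal path for \<open>(x, r)\<close>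
  until only its \<open>\<phi>\<close>-part is left, which \<open>N_shift\<close> absorbs.\<close>

lemma N_add: "N (r + s) (x + y) \<le> N r x + N s y"
proof (induction r arbitrary: x)
  case 0
  show ?case using N_shift[of s y x] by (simp add: add.commute)
next
  case (Suc r)
  obtain a where a: "a \<in> A" "N (Suc r) x = g a + N r (x + a)"
    using N_Suc_attained by blast
  have "N (Suc r + s) (x + y) \<le> g a + N (r + s) (x + y + a)"
    using N_Suc_le[OF a(1), of "r + s" "x + y"] by simp
  also have "\<dots> \<le> g a + (N r (x + a) + N s y)"
    using Suc[of "x + a"] by (simp add: algebra_simps)
  finally show ?case using a(2) by linarith
qed

text \<open>Two steps of opposite direction cancel at a cost bounded by \<open>g a + g b \<ge> \<phi> (a - b)\<close>.\<close>

lemma N_diff: "N r (x - y) \<le> N (r + s) x + N s y"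
proof (induction s arbitrary: x y)
  case 0
  show ?case using N_shift[of r x "- y"] norm_minus[of y] by simp
next
  case (Suc s)
  obtain a where a: "a \<in> A" "N (Suc (r + s)) x = g a + N (r + s) (x + a)"
    using N_Suc_attained by blast
  obtain b where b: "b \<in> A" "N (Suc s) y = g b + N s (y + b)"
    using N_Suc_attained by blast
  have "N r (x - y) \<le> \<phi> (b - a) + N r ((x + a) - (y + b))"
    using N_shift[of r "(x + a) - (y + b)" "b - a"] by (simp add: algebra_simps)
  also have "\<dots> \<le> (g a + g b) + (N (r + s) (x + a) + N s (y + b))"
    using g_sum[OF b(1) a(1)] Suc[of "x + a" "y + b"] by linarith
  finally show ?case using a(2) b(2) by simp
qed

lemma N_lower: "of_nat r * Min (g ` A) \<le> N r x"
proof (induction r arbitrary: x)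
  case 0
  show ?case using norm_nonneg by simp
next
  case (Suc r)
  obtain a where a: "a \<in> A" "N (Suc r) x = g a + N r (x + a)"
    using N_Suc_attained by blast
  have "Min (g ` A) \<le> g a" using a(1) fin by simp
  then show ?case using Suc[of "x + a"] a(2) by (simp add: algebra_simps)
qed

lemma g_min_pos: "0 < Min (g ` A)"
  using fin ne g_pos by simp

lemma finite_N_le: "finite {x. N r x \<le> B}"
proof (induction r arbitrary: B)
  case 0
  show ?case using norm_proper by simp
next
  case (Suc r)
  have "{x. N (Suc r) x \<le> B} \<subseteq> (\<Union>a\<in>A. (\<lambda>y. y - a) ` {y. N r y \<le> B})"
  proof
    fix x assume x: "x \<in> {x. N (Suc r) x \<le> B}"
    obtain a where a: "a \<in> A" "N (Suc r) x = g a + N r (x + a)"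
      using N_Suc_attained by blast
    have "N r (x + a) \<le> B" using x a(2) g_pos[OF a(1)] by simp
    then have "x \<in> (\<lambda>y. y - a) ` {y. N r y \<le> B}"
      by (intro image_eqI[of _ _ "x + a"]) auto
    then show "x \<in> (\<Union>a\<in>A. (\<lambda>y. y - a) ` {y. N r y \<le> B})" using a(1) by blast
  qed
  then show ?case by (rule finite_subset) (use Suc fin in auto)
qed

text \<open>The Lipschitz half of \<open>katetov\<close> says that another generator
  \<open>b\<close> followed by the correction \<open>\<phi> (b - a)\<close> is no cheaper than the
  direct step.\<close>

lemma N_one: "a \<in> A \<Longrightarrow> N 1 (- a) = g a"
proof (rule antisym)
  assume a: "a \<in> A"
  show "N 1 (- a) \<le> g a" using N_Suc_le[OF a, of 0 "- a"] norm_zero by simp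
  obtain b where b: "b \<in> A" "N (Suc 0) (- a) = g b + N 0 (- a + b)"
    using N_Suc_attained by blast
  show "g a \<le> N 1 (- a)"
    using g_lip[OF a b(1)] b(2) norm_minus[of "a - b"] by simp
qed

text \<open>The norm on all of Z^2, continued to negative \<open>r\<close> by evenness. The
  coordinate \<open>r\<close> counts the new generator.\<close>

definition Nz :: "int \<Rightarrow> int \<Rightarrow> rat" where
  "Nz r x = (if 0 \<le> r then N (nat r) x else N (nat (- r)) (- x))"

lemma Nz_minus: "Nz (- r) (- x) = Nz r x"
  by (auto simp: Nz_def norm_minus)

lemma Nz_zero: "Nz 0 x = \<phi> x"
  by (simp add: Nz_def)

text \<open>Steps of equal sign concatenate by \<open>N_add\<close>, steps of opposite sign cancel
  by \<open>N_diff\<close>; evenness reduces the claim to nonnegative \<open>r\<close>.\<close>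

lemma Nz_add: "Nz (r + s) (x + y) \<le> Nz r x + Nz s y"
proof -
  have main: "Nz (r + s) (x + y) \<le> Nz r x + Nz s y" if "0 \<le> r" for r s x y
  proof -
    consider "0 \<le> s" | "s < 0" "0 \<le> r + s" | "s < 0" "r + s < 0" by linarith
    then show ?thesis
    proof cases
      case 1
      then show ?thesis
        using that N_add[of "nat r" "nat s" x y] by (simp add: Nz_def nat_add_distrib)
    next
      case 2
      have "nat (r + s) + nat (- s) = nat r" using 2 by linarith
      then show ?thesis
        using that 2 N_diff[of "nat (r + s)" x "- y" "nat (- s)"] by (simp add: Nz_def)
    next
      case 3
      \<comment> \<open>Here the path for \<open>s\<close> is the longer one; after negation the
        path for \<open>r\<close> is cancelled against it.\<close>
      have "nat (- (r + s)) + nat r = nat (- s)" using 3 that by linarith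
      then have "N (nat (- (r + s))) (- y - x) \<le> N (nat (- s)) (- y) + N (nat r) x"
        using N_diff[of "nat (- (r + s))" "- y" x "nat r"] by (simp only:)
      moreover have "- (x + y) = - y - x" by simp
      ultimately show ?thesis
        unfolding Nz_def using that 3 by (simp only: if_True if_False not_le split: if_split) linarith
    qed
  qed
  show ?thesis
  proof (cases "0 \<le> r")
    case False
    then show ?thesis
      using main[of "- r" "- s" "- x" "- y"] Nz_minus[of "r + s" "x + y"]
        Nz_minus[of r x] Nz_minus[of s y]
      by (simp add: algebra_simps)
  qed (use main in auto)
qed

lemma Nz_lower: "of_int \<bar>r\<bar> * Min (g ` A) \<le> Nz r x"
  using N_lower[of "nat r" x] N_lower[of "nat (- r)" "- x"] by (auto simp: Nz_def)

text \<open>The lower bound confines \<open>r\<close> to a finite range, and each slice of constant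
  \<open>r\<close> is finite.\<close>

lemma finite_Nz_le: "finite {(r, x). Nz r x \<le> B}"
proof -
  obtain k :: nat where k: "B < of_nat k * Min (g ` A)"
    using ex_less_of_nat_mult[OF g_min_pos] by blast
  have fr: "finite {x. Nz r x \<le> B}" for r
  proof -
    have "{x. Nz r x \<le> B} \<subseteq> {x. N (nat r) x \<le> B} \<union> uminus ` {x. N (nat (- r)) x \<le> B}"
      by (auto simp: Nz_def image_iff split: if_splits) (metis minus_minus)
    then show ?thesis by (rule finite_subset) (use finite_N_le in auto)
  qed
  have "\<bar>r\<bar> \<le> int k" if "Nz r x \<le> B" for r x
  proof (rule ccontr)
    assume "\<not> \<bar>r\<bar> \<le> int k"
    then have "int k \<le> \<bar>r\<bar>" by simp
    then have "(of_nat k :: rat) \<le> of_int \<bar>r\<bar>" by (metis of_int_le_iff of_int_of_nat_eq)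
    then have "of_nat k * Min (g ` A) \<le> of_int \<bar>r\<bar> * Min (g ` A)"
      using g_min_pos by (intro mult_right_mono) auto
    then show False using k that Nz_lower[of r x] by linarith
  qed
  then have "{(r, x). Nz r x \<le> B} \<subseteq> (SIGMA r:{- int k..int k}. {x. Nz r x \<le> B})" by fastforce
  then show ?thesis by (rule finite_subset) (use fr in auto)
qed

lemma Nz_pos: assumes "r \<noteq> 0 \<or> x \<noteq> 0" shows "0 < Nz r x"
proof (cases "r = 0")
  case True
  then show ?thesis using assms norm_pos Nz_zero by simp
next
  case False
  then have "0 < of_int \<bar>r\<bar> * Min (g ` A)" using g_min_pos by simp
  then show ?thesis using Nz_lower[of r x] by linarith
qed

end

text \<open>The witness is the quotient norm: its value at \<open>n\<close> is the least norm in the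
  fibre of all \<open>(n - r * M, r)\<close>. Every large \<open>M\<close> is admissible, so that
  different requests can later be realized at the same integer.\<close>

lemma proper_norm_realize:
  assumes "proper_norm \<phi>" "katetov \<phi> A g"
  shows "\<exists>M0. \<forall>M\<ge>M0. \<exists>\<phi>'. proper_norm \<phi>' \<and> (\<forall>n. \<bar>n\<bar> \<le> K \<longrightarrow> \<phi>' n = \<phi> n) \<and>
    (\<forall>a\<in>A. \<phi>' (M - a) = g a)"
proof -
  interpret norm_request \<phi> A g using assms by unfold_locales
  \<comment> \<open>\<open>B\<close> dominates all values to be attained, \<open>X\<close> the first
    coordinates of all lattice points of norm at most \<open>B\<close>, and \<open>k\<close> the set
    \<open>A\<close>. The inserted zeros keep \<open>X\<close> and \<open>k\<close>
    nonnegative.\<close>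
  define B where "B = Max (\<phi> ` {- \<bar>K\<bar>..\<bar>K\<bar>} \<union> g ` A)"
  have B: "\<phi> n \<le> B" if "\<bar>n\<bar> \<le> \<bar>K\<bar>" for n
  proof -
    have "- \<bar>K\<bar> \<le> n \<and> n \<le> \<bar>K\<bar>" using that by linarith
    then have "\<phi> n \<in> \<phi> ` {- \<bar>K\<bar>..\<bar>K\<bar>}" by (intro imageI) (simp only: atLeastAtMost_iff)
    then show ?thesis unfolding B_def using fin by (intro Max_ge finite_UnI finite_imageI UnI1) auto
  qed
  have Bg: "g a \<le> B" if "a \<in> A" for a
    unfolding B_def using that fin by (intro Max_ge) auto
  define X where "X = Max (insert 0 ((\<lambda>(r, x). \<bar>x\<bar>) ` {(r, x). Nz r x \<le> B}))"
  have X: "\<bar>x\<bar> \<le> X" if "Nz r x \<le> B" for r x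
    unfolding X_def using that finite_Nz_le[of B]
    by (intro Max_ge insertI2 image_eqI[of _ _ "(r, x)"] finite.insertI finite_imageI) auto
  define k where "k = Max (insert 0 (abs ` A))"
  have k: "\<bar>a\<bar> \<le> k" if "a \<in> A" for a
    unfolding k_def using that fin by (intro Max_ge) auto
  have "\<exists>\<phi>'. proper_norm \<phi>' \<and> (\<forall>n. \<bar>n\<bar> \<le> K \<longrightarrow> \<phi>' n = \<phi> n) \<and> (\<forall>a\<in>A. \<phi>' (M - a) = g a)"
    if M: "M \<ge> X + \<bar>K\<bar> + \<bar>k\<bar> + 1" for M
  proof -
    have X0: "0 \<le> X" unfolding X_def using finite_Nz_le[of B] by (intro Max_ge) auto
    \<comment> \<open>Two points of one fibre differ by a nonzero multiple of \<open>M\<close> in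
      the first coordinate, too far for points within \<open>X\<close> and
      \<open>\<bar>K\<bar> + \<bar>k\<bar>\<close> of 0.\<close>
    have unique: "r = s" if "\<bar>n - r * M\<bar> \<le> X" "\<bar>n - s * M\<bar> \<le> \<bar>K\<bar> + \<bar>k\<bar>" for n r s
    proof (rule ccontr)
      assume "r \<noteq> s"
      then have "1 \<le> \<bar>s - r\<bar>" by linarith
      then have "\<bar>M\<bar> \<le> \<bar>s - r\<bar> * \<bar>M\<bar>" using mult_right_mono[of 1 "\<bar>s - r\<bar>" "\<bar>M\<bar>"] by simp
      also have "\<dots> = \<bar>(n - r * M) - (n - s * M)\<bar>" 
        unfolding abs_mult[symmetric] by (simp add: algebra_simps)
      finally show False using that M X0 by linarith
    qed
    \<comment> \<open>The fibre point with \<open>r = 0\<close> has norm \<open>\<phi> n\<close>, so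
      the infimum over the infinite fibre is a minimum over the finite set
      \<open>?R\<close>.\<close>
    have "\<exists>\<rho>. \<forall>r. Nz \<rho> (n - \<rho> * M) \<le> Nz r (n - r * M)" for n
    proof -
      let ?R = "{r. Nz r (n - r * M) \<le> \<phi> n}"
      have "finite ((\<lambda>r. (r, n - r * M)) ` ?R)"
        by (rule finite_subset[OF _ finite_Nz_le[of "\<phi> n"]]) auto
      then have finR: "finite ?R" by (rule finite_imageD) (auto simp: inj_on_def)
      have 0: "0 \<in> ?R" using Nz_zero by simp
      define f where "f r = Nz r (n - r * M)" for r
      have "Min (f ` ?R) \<in> f ` ?R" using finR 0 by (intro Min_in) blast+
      then obtain \<rho> where "\<rho> \<in> ?R" "f \<rho> = Min (f ` ?R)" by force
      then have \<rho>: "\<rho> \<in> ?R" "\<forall>r\<in>?R. f \<rho> \<le> f r" using finR by auto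
      have "f \<rho> \<le> f r" for r
        using \<rho> by (cases "r \<in> ?R") (auto simp: f_def)
      then show ?thesis unfolding f_def by blast
    qed
    then obtain \<rho> where \<rho>: "\<And>n r. Nz (\<rho> n) (n - \<rho> n * M) \<le> Nz r (n - r * M)" by metis
    define \<psi> where "\<psi> n = Nz (\<rho> n) (n - \<rho> n * M)" for n
    have le: "\<psi> n \<le> Nz r (n - r * M)" for n r using \<rho> by (simp add: \<psi>_def)
    \<comment> \<open>A fibre point near 0 of norm at most \<open>B\<close> must be the minimizer:
      the minimizer also has norm at most \<open>B\<close>, so \<open>X\<close> bounds its first
      coordinate and \<open>unique\<close> applies.\<close>
    have eq: "\<psi> n = Nz s (n - s * M)" if "Nz s (n - s * M) \<le> B" "\<bar>n - s * M\<bar> \<le> \<bar>K\<bar> + \<bar>k\<bar>" for n s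
    proof -
      have "\<psi> n \<le> B" using le[of n s] that(1) by linarith
      then have "\<rho> n = s" using unique[OF X that(2)] by (simp add: \<psi>_def)
      then show ?thesis by (simp add: \<psi>_def)
    qed
    have agree: "\<psi> n = \<phi> n" if "\<bar>n\<bar> \<le> \<bar>K\<bar>" for n
      using eq[of 0 n] B that by (simp add: Nz_zero)
    have real: "\<psi> (M - a) = g a" if "a \<in> A" for a
    proof -
      have "Nz 1 (- a) = g a" using N_one[OF that] by (simp add: Nz_def)
      then show ?thesis using eq[of 1 "M - a"] Bg[OF that] k[OF that] by simp
    qed
    have "proper_norm \<psi>"
      unfolding proper_norm_def
    proof (intro conjI allI impI)
      show "\<psi> 0 = 0" using agree norm_zero by simp
      show "0 < \<psi> n" if "n \<noteq> 0" for n
        unfolding \<psi>_def by (rule Nz_pos) (use that in auto)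
      have "\<psi> (- n) \<le> \<psi> n" for n
        using le[of "- n" "- \<rho> n"] Nz_minus[of "\<rho> n" "n - \<rho> n * M"] by (simp add: \<psi>_def)
      from this[of n for n] this[of "- n" for n] show "\<psi> (- n) = \<psi> n" for n
        by (simp add: order_antisym)
      show "\<psi> (m + n) \<le> \<psi> m + \<psi> n" for m n
        using le[of "m + n" "\<rho> m + \<rho> n"] Nz_add[of "\<rho> m" "\<rho> n" "m - \<rho> m * M" "n - \<rho> n * M"]
        by (simp add: \<psi>_def algebra_simps)
      show "finite {n. \<psi> n \<le> C}" for C
      proof (rule finite_subset)
        show "{n. \<psi> n \<le> C} \<subseteq> (\<lambda>(r, x). x + r * M) ` {(r, x). Nz r x \<le> C}"
        proof
          fix n assume "n \<in> {n. \<psi> n \<le> C}"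
          then show "n \<in> (\<lambda>(r, x). x + r * M) ` {(r, x). Nz r x \<le> C}"
            by (intro image_eqI[of _ _ "(\<rho> n, n - \<rho> n * M)"]) (auto simp: \<psi>_def)
        qed
      qed (use finite_Nz_le in auto)
    qed
    then show ?thesis using agree real by (intro exI[of _ \<psi>]) auto
  qed
  then show ?thesis by blast
qed

section \<open>Translation-invariant rational Urysohn metrics on the integers\<close>

definition stage_step ::
    "(int \<Rightarrow> rat) \<Rightarrow> int \<Rightarrow> (int \<times> rat) list \<Rightarrow> (bool \<Rightarrow> int \<Rightarrow> rat) \<Rightarrow> int \<Rightarrow> bool" where
  "stage_step \<phi> K p \<psi> K' \<longleftrightarrow> K < K' \<and> (\<exists>n. \<bar>n\<bar> \<le> K' \<and> \<psi> True n \<noteq> \<psi> False n) \<and>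
     (\<forall>b. proper_norm (\<psi> b) \<and> (\<forall>n. \<bar>n\<bar> \<le> K \<longrightarrow> \<psi> b n = \<phi> n) \<and>
       (katetov \<phi> (fst ` set p) (the \<circ> map_of p) \<and>
          (\<forall>a\<in>fst ` set p. \<forall>a'\<in>fst ` set p. \<bar>a - a'\<bar> \<le> K) \<longrightarrow>
        (\<exists>z. \<forall>a\<in>fst ` set p. \<bar>z - a\<bar> \<le> K' \<and> \<psi> b (z - a) = the (map_of p a))))"

text \<open>\<open>proper_norm_realize\<close> is applied twice: to a one-point request that records
  the bit, then to \<open>p\<close> with the place of the bit frozen.\<close>

lemma ex_stage_step:
  assumes "proper_norm \<phi>" "0 \<le> K"
  shows "\<exists>\<psi> K'. stage_step \<phi> K p \<psi> K'"
proof -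
  let ?A = "fst ` set p" and ?g = "the \<circ> map_of p"
  \<comment> \<open>The bit is recorded as a distance 1 or 2 from 0; on the single point 0 every
    positive constant is a Katetov function.\<close>
  define c :: "bool \<Rightarrow> rat" where "c b = (if b then 1 else 2)" for b
  have "katetov \<phi> {0} (\<lambda>_. c b)" for b
    using assms(1) by (simp add: katetov_def proper_norm_def c_def)
  then have "\<exists>M0. \<forall>M\<ge>M0. \<exists>\<phi>'. proper_norm \<phi>' \<and> (\<forall>n. \<bar>n\<bar> \<le> K \<longrightarrow> \<phi>' n = \<phi> n) \<and> \<phi>' M = c b" for b
    using proper_norm_realize[OF assms(1), of "{0}" "\<lambda>_. c b" K] by simp
  then obtain M0 where M0: "\<And>b M. M0 b \<le> M \<Longrightarrow>
      \<exists>\<phi>'. proper_norm \<phi>' \<and> (\<forall>n. \<bar>n\<bar> \<le> K \<longrightarrow> \<phi>' n = \<phi> n) \<and> \<phi>' M = c b"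
    by metis
  define M where "M = max (M0 True) (M0 False)"
  have "M0 b \<le> M" for b by (cases b) (auto simp: M_def)
  then have "\<forall>b. \<exists>\<phi>'. proper_norm \<phi>' \<and> (\<forall>n. \<bar>n\<bar> \<le> K \<longrightarrow> \<phi>' n = \<phi> n) \<and> \<phi>' M = c b"
    using M0 by blast
  then obtain \<phi>' where \<phi>': "\<And>b. proper_norm (\<phi>' b)" "\<And>b n. \<bar>n\<bar> \<le> K \<Longrightarrow> \<phi>' b n = \<phi> n"
      "\<And>b. \<phi>' b M = c b"
    unfolding choice_iff by blast
  define L where "L = max K \<bar>M\<bar>"
  have "\<exists>\<psi> z. proper_norm \<psi> \<and> (\<forall>n. \<bar>n\<bar> \<le> L \<longrightarrow> \<psi> n = \<phi>' b n) \<and>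
      (katetov \<phi> ?A ?g \<and> (\<forall>a\<in>?A. \<forall>a'\<in>?A. \<bar>a - a'\<bar> \<le> K) \<longrightarrow> (\<forall>a\<in>?A. \<psi> (z - a) = ?g a))" for b
  proof (cases "katetov \<phi> ?A ?g \<and> (\<forall>a\<in>?A. \<forall>a'\<in>?A. \<bar>a - a'\<bar> \<le> K)")
    case True
    then have "katetov (\<phi>' b) ?A ?g" by (simp add: katetov_def \<phi>'(2))
    from proper_norm_realize[OF \<phi>'(1) this, of L] show ?thesis by blast
  next
    case False
    then show ?thesis using \<phi>'(1)[of b] by blast
  qed
  then obtain \<psi> z where \<psi>: "\<And>b. proper_norm (\<psi> b)" "\<And>b n. \<bar>n\<bar> \<le> L \<Longrightarrow> \<psi> b n = \<phi>' b n"
      "\<And>b a. katetov \<phi> ?A ?g \<Longrightarrow> \<forall>a\<in>?A. \<forall>a'\<in>?A. \<bar>a - a'\<bar> \<le> K \<Longrightarrow> a \<in> ?A \<Longrightarrow> \<psi> b (z b - a) = ?g a"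
    by metis
  \<comment> \<open>\<open>L + 1\<close> makes the radius grow strictly; the other entries cover the
    witnesses for both bits.\<close>
  define K' where "K' = Max (insert (L + 1) ((\<lambda>(b, a). \<bar>z b - a\<bar>) ` (UNIV \<times> ?A)))"
  have LK': "L + 1 \<le> K'" unfolding K'_def by (intro Max_ge) auto
  have zK': "\<bar>z b - a\<bar> \<le> K'" if "a \<in> ?A" for a b
    unfolding K'_def by (intro Max_ge) (use that in force)+
  have "\<psi> True M \<noteq> \<psi> False M" using \<psi>(2)[of M] \<phi>'(3) by (simp add: L_def c_def)
  moreover have "\<bar>M\<bar> \<le> K'" using LK' by (simp add: L_def)
  moreover have "\<psi> b n = \<phi> n" if "\<bar>n\<bar> \<le> K" for b n
    using \<psi>(2)[of n b] \<phi>'(2) that by (simp add: L_def)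
  moreover have "K < K'" using LK' by (simp add: L_def)
  moreover have "\<exists>z. \<forall>a\<in>?A. \<bar>z - a\<bar> \<le> K' \<and> \<psi> b (z - a) = the (map_of p a)"
    if "katetov \<phi> ?A ?g \<and> (\<forall>a\<in>?A. \<forall>a'\<in>?A. \<bar>a - a'\<bar> \<le> K)" for b
    using \<psi>(3)[of _ b] that zK' by (intro exI[of _ "z b"]) auto
  ultimately have "stage_step \<phi> K p \<psi> K'"
    unfolding stage_step_def using \<psi>(1) by blast
  then show ?thesis by blast
qed

text \<open>Every request recurs at arbitrarily late stages, so that the distances between its points
  are already final when it is treated.\<close>

definition request :: "nat \<Rightarrow> (int \<times> rat) list" where
  "request i = from_nat (fst (prod_decode i))"

text \<open>Both versions of the next norm and the radius are chosen before \<open>S\<close> is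
  consulted, so \<open>stage S i\<close> depends on \<open>S\<close> only below
  \<open>i\<close>.\<close>

primrec stage :: "nat set \<Rightarrow> nat \<Rightarrow> (int \<Rightarrow> rat) \<times> int" where
  "stage S 0 = (\<lambda>n. of_int \<bar>n\<bar>, 0)"
| "stage S (Suc i) =
    (let (\<psi>, K) = SOME (\<psi>, K). stage_step (fst (stage S i)) (snd (stage S i)) (request i) \<psi> K
     in (\<psi> (i \<in> S), K))"

text \<open>The window of stage \<open>\<bar>n\<bar>\<close> has radius at least
  \<open>\<bar>n\<bar>\<close>, so the value there at \<open>n\<close> is final.\<close>

definition limit_norm :: "nat set \<Rightarrow> int \<Rightarrow> rat" where
  "limit_norm S n = fst (stage S (nat \<bar>n\<bar>)) n"

section \<open>Stabilization of the stages\<close>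

lemma proper_norm_abs: "proper_norm (\<lambda>n. of_int \<bar>n\<bar>)"
proof -
  have "finite {n :: int. (of_int \<bar>n\<bar> :: rat) \<le> B}" for B
  proof (rule finite_subset)
    show "{n. (of_int \<bar>n\<bar> :: rat) \<le> B} \<subseteq> {- \<lfloor>B\<rfloor>..\<lfloor>B\<rfloor>}"
    proof
      fix n assume "n \<in> {n. (of_int \<bar>n\<bar> :: rat) \<le> B}"
      then have "\<bar>n\<bar> \<le> \<lfloor>B\<rfloor>" by (simp add: le_floor_iff)
      then show "n \<in> {- \<lfloor>B\<rfloor>..\<lfloor>B\<rfloor>}" by auto
    qed
  qed auto
  moreover have "(of_int \<bar>m + n\<bar> :: rat) \<le> of_int \<bar>m\<bar> + of_int \<bar>n\<bar>" for m n
    unfolding of_int_add[symmetric] of_int_le_iff by (rule abs_triangle_ineq)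
  ultimately show ?thesis by (auto simp: proper_norm_def)
qed

lemma stage_step_some:
  assumes "proper_norm \<phi>" "0 \<le> K"
  obtains \<psi> K' where "(SOME (\<psi>, K'). stage_step \<phi> K p \<psi> K') = (\<psi>, K')" "stage_step \<phi> K p \<psi> K'"
proof -
  have "\<exists>x. case x of (\<psi>, K') \<Rightarrow> stage_step \<phi> K p \<psi> K'"
    using ex_stage_step[OF assms] by auto
  from someI_ex[OF this] show thesis using that by (auto split: prod.splits)
qed

lemma stage_invariant: "proper_norm (fst (stage S i)) \<and> int i \<le> snd (stage S i)"
proof (induction i)
  case 0
  show ?case using proper_norm_abs by simp
next
  case (Suc i)
  then have "proper_norm (fst (stage S i))" "0 \<le> snd (stage S i)" by auto
  from stage_step_some[OF this, of "request i"] obtain \<psi> K'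
    where "(SOME (\<psi>, K'). stage_step (fst (stage S i)) (snd (stage S i)) (request i) \<psi> K') = (\<psi>, K')"
      "stage_step (fst (stage S i)) (snd (stage S i)) (request i) \<psi> K'" .
  then show ?case using Suc by (auto simp: stage_step_def)
qed

text \<open>One pair serves all sets \<open>T\<close> that share the stage with \<open>S\<close>, so
  two sets can be compared at the first index where they differ.\<close>

lemma stage_Suc:
  obtains \<psi> K' where "stage_step (fst (stage S i)) (snd (stage S i)) (request i) \<psi> K'"
    "\<And>T. stage T i = stage S i \<Longrightarrow> stage T (Suc i) = (\<psi> (i \<in> T), K')"
proof -
  have "proper_norm (fst (stage S i))" "0 \<le> snd (stage S i)"
    using stage_invariant[of S i] by auto
  from stage_step_some[OF this, of "request i"] obtain \<psi> K'
    where "(SOME (\<psi>, K'). stage_step (fst (stage S i)) (snd (stage S i)) (request i) \<psi> K') = (\<psi>, K')"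
      "stage_step (fst (stage S i)) (snd (stage S i)) (request i) \<psi> K'" .
  then show thesis by (intro that) auto
qed

lemma stage_agree:
  assumes "i \<le> j" "\<bar>n\<bar> \<le> snd (stage S i)"
  shows "fst (stage S j) n = fst (stage S i) n \<and> snd (stage S i) \<le> snd (stage S j)"
  using assms(1)
proof (induction j rule: dec_induct)
  case (step j)
  obtain \<psi> K' where "stage_step (fst (stage S j)) (snd (stage S j)) (request j) \<psi> K'"
    "stage S (Suc j) = (\<psi> (j \<in> S), K')"
    using stage_Suc[of S j] by metis
  then show ?case using step assms(2) by (auto simp: stage_step_def)
qed simp

lemma limit_norm_eq:
  assumes "\<bar>n\<bar> \<le> snd (stage S i)"
  shows "limit_norm S n = fst (stage S i) n"
proof -
  have n: "\<bar>n\<bar> \<le> snd (stage S (nat \<bar>n\<bar>))" using stage_invariant[of S "nat \<bar>n\<bar>"] by simp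
  show ?thesis
    using stage_agree[OF _ n, of i] stage_agree[OF _ assms, of "nat \<bar>n\<bar>"]
    by (cases "i \<le> nat \<bar>n\<bar>") (auto simp: limit_norm_def)
qed

text \<open>Each norm axiom mentions finitely many integers, so it is inherited from one stage whose
  window contains them.\<close>

lemma limit_norm_stage:
  obtains i where "proper_norm (fst (stage S i))" "\<And>n. \<bar>n\<bar> \<le> B \<Longrightarrow> limit_norm S n = fst (stage S i) n"
proof
  show "proper_norm (fst (stage S (nat B)))" using stage_invariant by blast
  show "limit_norm S n = fst (stage S (nat B)) n" if "\<bar>n\<bar> \<le> B" for n
    by (rule limit_norm_eq) (use stage_invariant[of S "nat B"] that in linarith)
qed

section \<open>Metric axioms and extension property of the limit\<close>

lemma limit_norm_zero: "limit_norm S 0 = 0"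
  by (simp add: limit_norm_def)

lemma limit_norm_pos: "n \<noteq> 0 \<Longrightarrow> 0 < limit_norm S n"
  by (rule limit_norm_stage[of S "\<bar>n\<bar>"]) (auto simp: proper_norm_def)

lemma limit_norm_minus: "limit_norm S (- n) = limit_norm S n"
  by (rule limit_norm_stage[of S "\<bar>n\<bar>"]) (auto simp: proper_norm_def)

lemma limit_norm_add: "limit_norm S (m + n) \<le> limit_norm S m + limit_norm S n"
  by (rule limit_norm_stage[of S "\<bar>m\<bar> + \<bar>n\<bar>"]) (auto simp: proper_norm_def)

text \<open>The request is served at a stage whose window holds all differences of \<open>A\<close>;
  the distances to the new point are frozen from the next stage on.\<close>

lemma limit_norm_realize:
  assumes kat: "katetov (limit_norm S) A g"
  shows "\<exists>z. \<forall>a\<in>A. limit_norm S (z - a) = g a"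
proof -
  have fin: "finite A" using kat by (simp add: katetov_def)
  define p where "p = map (\<lambda>a. (a, g a)) (sorted_list_of_set A)"
  have A: "fst ` set p = A" using fin by (force simp: p_def)
  have g: "the (map_of p a) = g a" if "a \<in> A" for a
    using that fin by (simp add: p_def map_of_map_restrict)
  define B where "B = Max (insert 0 ((\<lambda>(a, a'). \<bar>a - a'\<bar>) ` (A \<times> A)))"
  have B: "\<bar>a - a'\<bar> \<le> B" if "a \<in> A" "a' \<in> A" for a a'
    unfolding B_def by (intro Max_ge) (use that fin in force)+
  \<comment> \<open>The second component is free; \<open>nat B\<close> makes \<open>i\<close> at
    least \<open>nat B\<close>, so the window at stage \<open>i\<close> has radius at least
    \<open>B\<close>.\<close>
  define i where "i = prod_encode (to_nat p, nat B)"
  have req: "request i = p" by (simp add: request_def i_def)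
  have "nat B \<le> i" by (simp add: i_def le_prod_encode_2)
  then have Ki: "B \<le> snd (stage S i)" using stage_invariant[of S i] by linarith
  have lim: "limit_norm S (a - a') = fst (stage S i) (a - a')" if "a \<in> A" "a' \<in> A" for a a'
    using B[OF that] Ki by (intro limit_norm_eq) linarith
  have kat': "katetov (fst (stage S i)) A (the \<circ> map_of p)"
    using kat lim g by (simp add: katetov_def)
  obtain \<psi> K' where step: "stage_step (fst (stage S i)) (snd (stage S i)) p \<psi> K'"
    "stage S (Suc i) = (\<psi> (i \<in> S), K')"
    using stage_Suc[of S i] req by metis
  have "\<forall>a\<in>A. \<forall>a'\<in>A. \<bar>a - a'\<bar> \<le> snd (stage S i)" using B Ki by force
  then obtain z where z: "\<forall>a\<in>A. \<bar>z - a\<bar> \<le> K' \<and> \<psi> (i \<in> S) (z - a) = g a"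
    using step(1) kat' g unfolding stage_step_def A by metis
  have "limit_norm S (z - a) = g a" if "a \<in> A" for a
    using limit_norm_eq[of "z - a" S "Suc i"] step(2) z that by auto
  then show ?thesis by blast
qed

text \<open>At the least index where \<open>S\<close> and \<open>T\<close> differ their stages
  coincide, and the next stage freezes different values at some \<open>n\<close>.\<close>

lemma inj_limit_norm: "inj limit_norm"
proof (rule injI, rule ccontr)
  fix S T assume eq: "limit_norm S = limit_norm T" and "S \<noteq> T"
  then have "\<exists>i. (i \<in> S) \<noteq> (i \<in> T)" by auto
  then obtain i where i: "(i \<in> S) \<noteq> (i \<in> T)" and less: "\<And>j. j < i \<Longrightarrow> (j \<in> S) = (j \<in> T)"
    using exists_least_iff[of "\<lambda>i. (i \<in> S) \<noteq> (i \<in> T)"] by blast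
  have "j \<le> i \<Longrightarrow> stage T j = stage S j" for j
  proof (induction j)
    case (Suc j)
    then show ?case using less[of j] by (simp add: Let_def)
  qed simp
  then have ST: "stage T i = stage S i" by simp
  obtain \<psi> K' where step: "stage_step (fst (stage S i)) (snd (stage S i)) (request i) \<psi> K'"
    and Suc: "\<And>T. stage T i = stage S i \<Longrightarrow> stage T (Suc i) = (\<psi> (i \<in> T), K')"
    using stage_Suc[of S i] by blast
  obtain n where n: "\<bar>n\<bar> \<le> K'" "\<psi> True n \<noteq> \<psi> False n"
    using step by (auto simp: stage_step_def)
  have "limit_norm S n = \<psi> (i \<in> S) n" "limit_norm T n = \<psi> (i \<in> T) n"
    using limit_norm_eq[of n _ "Suc i"] Suc[OF ST] Suc[OF refl] n(1) by auto
  then show False using eq i n(2) by (cases "i \<in> S") auto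
qed

lemma rational_urysohn_space_limit_norm:
  "rational_urysohn_space UNIV (\<lambda>m n. real_of_rat (limit_norm S (m - n)))"
  unfolding rational_urysohn_space_def
proof (intro conjI allI impI)
  let ?\<phi> = "limit_norm S"
  have nonneg: "0 \<le> ?\<phi> n" for n
    using limit_norm_zero[of S] limit_norm_pos[of n S] by (cases "n = 0") auto
  show "Metric_space UNIV (\<lambda>m n. real_of_rat (?\<phi> (m - n)))"
  proof
    show "0 \<le> real_of_rat (?\<phi> (m - n))" for m n using nonneg by simp
    show "real_of_rat (?\<phi> (m - n)) = real_of_rat (?\<phi> (n - m))" for m n
      using limit_norm_minus[of S "n - m"] by simp
    show "(real_of_rat (?\<phi> (m - n)) = 0) = (m = n)" for m n
      using limit_norm_zero[of S] limit_norm_pos[of "m - n" S] by (cases "m = n") auto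
    show "real_of_rat (?\<phi> (l - n)) \<le> real_of_rat (?\<phi> (l - m)) + real_of_rat (?\<phi> (m - n))" for l m n
      using limit_norm_add[of S "l - m" "m - n"] by (simp flip: of_rat_add add: of_rat_less_eq)
  qed
  fix A :: "int set" and g :: "int \<Rightarrow> real"
  assume A: "finite A \<and> A \<subseteq> UNIV \<and> (\<forall>a\<in>A. g a \<in> \<rat> \<and> 0 \<le> g a) \<and>
    (\<forall>a\<in>A. \<forall>b\<in>A. \<bar>g a - g b\<bar> \<le> real_of_rat (?\<phi> (a - b)) \<and> real_of_rat (?\<phi> (a - b)) \<le> g a + g b)"
  show "\<exists>z\<in>UNIV. \<forall>a\<in>A. real_of_rat (?\<phi> (z - a)) = g a"
  \<comment> \<open>\<open>katetov\<close> demands positive values. A zero at \<open>a\<close>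
    forces \<open>g b\<close> to be the distance from \<open>a\<close> to \<open>b\<close>, so
    \<open>a\<close> itself is the required point.\<close>
  proof (cases "\<exists>a\<in>A. g a = 0")
    case True
    then obtain a where a: "a \<in> A" "g a = 0" by blast
    have "real_of_rat (?\<phi> (a - b)) = g b" if "b \<in> A" for b
    proof -
      have "\<bar>g a - g b\<bar> \<le> real_of_rat (?\<phi> (a - b))" "real_of_rat (?\<phi> (a - b)) \<le> g a + g b" "0 \<le> g b"
        using A a(1) that by auto
      then show ?thesis using a(2) by linarith
    qed
    then show ?thesis by blast
  next
    case False
    have "\<exists>q. g a = real_of_rat q" if "a \<in> A" for a
      using A that by (auto simp: Rats_def)
    then obtain h where h: "\<And>a. a \<in> A \<Longrightarrow> g a = real_of_rat (h a)"
      by metis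
    show ?thesis
    proof (cases "A = {}")
      case ne: False
      have "katetov ?\<phi> A h"
        unfolding katetov_def
      proof (intro conjI ballI)
        show "finite A" using A by blast
        show "A \<noteq> {}" by (rule ne)
        show "0 < h a" if "a \<in> A" for a
        proof -
          have "0 \<le> g a" "g a \<noteq> 0" using A False that by auto
          then show ?thesis using h[OF that] by simp
        qed
        fix a b assume ab: "a \<in> A" "b \<in> A"
        then have "\<bar>g a - g b\<bar> \<le> real_of_rat (?\<phi> (a - b))" "real_of_rat (?\<phi> (a - b)) \<le> g a + g b"
          using A by auto
        then have "real_of_rat (h a) \<le> real_of_rat (h b + ?\<phi> (a - b))"
            "real_of_rat (?\<phi> (a - b)) \<le> real_of_rat (h a + h b)"
          using ab h by (auto simp: of_rat_add)
        then show "h a \<le> h b + ?\<phi> (a - b)" "?\<phi> (a - b) \<le> h a + h b"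
          by (auto simp: of_rat_less_eq)
      qed
      from limit_norm_realize[OF this] show ?thesis using h by auto
    qed simp
  qed
qed auto

section \<open>Uniqueness of the rational Urysohn space\<close>

lemma rational_urysohn_point:
  assumes "rational_urysohn_space Q d" "finite A" "A \<subseteq> Q" "\<And>a. a \<in> A \<Longrightarrow> g a \<in> \<rat> \<and> 0 \<le> g a"
    and "\<And>a b. a \<in> A \<Longrightarrow> b \<in> A \<Longrightarrow> \<bar>g a - g b\<bar> \<le> d a b \<and> d a b \<le> g a + g b"
  shows "\<exists>z\<in>Q. \<forall>a\<in>A. d z a = g a"
proof -
  have "\<forall>A g. finite A \<and> A \<subseteq> Q \<and> (\<forall>a\<in>A. g a \<in> \<rat> \<and> 0 \<le> g a) \<and>
       (\<forall>a\<in>A. \<forall>b\<in>A. \<bar>g a - g b\<bar> \<le> d a b \<and> d a b \<le> g a + g b) \<longrightarrow>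
       (\<exists>z\<in>Q. \<forall>a\<in>A. d z a = g a)"
    using assms(1) unfolding rational_urysohn_space_def by (elim conjE)
  from this[rule_format, of A g] show ?thesis using assms(2-) by simp
qed

text \<open>One step of back-and-forth: the distances from \<open>x\<close>, carried along
  \<open>R\<close>, satisfy the triangle inequalities in \<open>Q\<close>. With a relation in place
  of a function, the converse serves the other direction.\<close>

lemma rational_urysohn_extend:
  assumes Q: "rational_urysohn_space Q e" and P: "rational_urysohn_space P d"
    and R: "finite R" "R \<subseteq> P \<times> Q"
    and iso': "\<forall>(a, b)\<in>R. \<forall>(a', b')\<in>R. d a a' = e b b'"
    and x: "x \<in> P"
  shows "\<exists>y\<in>Q. \<forall>(a, b)\<in>R. d x a = e y b"
proof -
  interpret P: Metric_space P d using P by (simp add: rational_urysohn_space_def)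
  interpret Q: Metric_space Q e using Q by (simp add: rational_urysohn_space_def)
  have iso: "d a a' = e b b'" if "(a, b) \<in> R" "(a', b') \<in> R" for a b a' b'
    using iso' that by blast
  \<comment> \<open>The choice is harmless: two partners of \<open>b\<close> are at distance
    \<open>e b b = 0\<close>.\<close>
  define g where "g b = d x (SOME a. (a, b) \<in> R)" for b
  have g: "g b = d x a" if ab: "(a, b) \<in> R" for a b
  proof -
    have some: "(SOME a. (a, b) \<in> R, b) \<in> R" using ab by (rule someI)
    then have mem: "a \<in> P" "(SOME a. (a, b) \<in> R) \<in> P" "b \<in> Q" using ab R(2) by blast+
    have "(SOME a. (a, b) \<in> R) = a" using iso[OF some ab] mem by simp
    then show ?thesis by (simp add: g_def)
  qed
  have "\<exists>y\<in>Q. \<forall>b\<in>snd ` R. e y b = g b"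
  proof -
    have "d x a \<in> \<rat>" if "a \<in> P" for a
      using P x that by (simp add: rational_urysohn_space_def)
    then have "g b \<in> \<rat> \<and> 0 \<le> g b" if "b \<in> snd ` R" for b
      using g R(2) that by auto
    moreover have "\<bar>g b - g b'\<bar> \<le> e b b' \<and> e b b' \<le> g b + g b'"
      if "b \<in> snd ` R" "b' \<in> snd ` R" for b b'
    proof -
      from that obtain a a' where a: "(a, b) \<in> R" "(a', b') \<in> R" by auto
      with R(2) have aP: "a \<in> P" "a' \<in> P" by auto
      show ?thesis
        using P.triangle[OF x aP] P.triangle[OF x aP(2) aP(1)] P.triangle[OF aP(1) x aP(2)]
          P.commute[of a a'] P.commute[of a x] g[OF a(1)] g[OF a(2)] iso[OF a] by linarith
    qed
    moreover have "finite (snd ` R)" "snd ` R \<subseteq> Q" using R by auto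
    ultimately show ?thesis by (intro rational_urysohn_point[OF Q]) blast+
  qed
  then show ?thesis using g by force
qed

lemma rational_urysohn_nonempty: "rational_urysohn_space Q d \<Longrightarrow> Q \<noteq> {}"
  unfolding rational_urysohn_space_def by (metis all_not_in_conv empty_subsetI finite.emptyI)

text \<open>Back-and-forth along enumerations of both spaces; the union of the finite partial
  isometries is the graph of a bijection.\<close>

lemma rational_urysohn_unique:
  assumes P: "rational_urysohn_space P d" and Q: "rational_urysohn_space Q e"
  obtains f where "bij_betw f P Q" "isometric_on P d e f"
proof -
  interpret P: Metric_space P d using P by (simp add: rational_urysohn_space_def)
  interpret Q: Metric_space Q e using Q by (simp add: rational_urysohn_space_def)
  define iso where "iso R \<longleftrightarrow> finite R \<and> R \<subseteq> P \<times> Q \<and>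
    (\<forall>(a, b)\<in>R. \<forall>(a', b')\<in>R. d a a' = e b b')" for R
  have ne: "P \<noteq> {}" "Q \<noteq> {}" using P Q rational_urysohn_nonempty by auto
  define p where "p = from_nat_into P"
  define q where "q = from_nat_into Q"
  have p: "range p = P" and q: "range q = Q"
    using P Q ne by (auto simp: p_def q_def range_from_nat_into rational_urysohn_space_def)
  have forw: "\<exists>R'. iso R' \<and> R \<subseteq> R' \<and> x \<in> fst ` R'" if R: "iso R" and x: "x \<in> P" for R x
  proof -
    have "finite R" "R \<subseteq> P \<times> Q" "\<forall>(a, b)\<in>R. \<forall>(a', b')\<in>R. d a a' = e b b'"
      using R by (simp_all add: iso_def)
    from rational_urysohn_extend[OF Q P this x]
    obtain y where y: "y \<in> Q" "\<forall>(a, b)\<in>R. d x a = e y b" by blast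
    have "iso (insert (x, y) R)"
      using R x y P.commute Q.commute unfolding iso_def by auto
    then show ?thesis by (intro exI[of _ "insert (x, y) R"]) auto
  qed
  have backw: "\<exists>R'. iso R' \<and> R \<subseteq> R' \<and> y \<in> snd ` R'" if R: "iso R" and y: "y \<in> Q" for R y
  proof -
    have inv: "finite (R\<inverse>)" "R\<inverse> \<subseteq> Q \<times> P" using R by (auto simp: iso_def)
    have "\<forall>(b, a)\<in>R\<inverse>. \<forall>(b', a')\<in>R\<inverse>. e b b' = d a a'"
      using R by (fastforce simp: iso_def)
    from rational_urysohn_extend[OF P Q inv this y]
    obtain x where x: "x \<in> P" "\<forall>(b, a)\<in>R\<inverse>. e y b = d x a" by blast
    have x': "\<forall>(a, b)\<in>R. d x a = e y b"
    proof clarify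
      fix a b assume "(a, b) \<in> R"
      then have "(b, a) \<in> R\<inverse>" by simp
      then show "d x a = e y b" using x(2) by force
    qed
    have "iso (insert (x, y) R)"
      using R x(1) x' y P.commute Q.commute unfolding iso_def by auto
    then show ?thesis by (intro exI[of _ "insert (x, y) R"]) auto
  qed
  have "\<exists>R. \<forall>n. iso (R n) \<and> (R n \<subseteq> R (Suc n) \<and> p n \<in> fst ` R (Suc n) \<and> q n \<in> snd ` R (Suc n))"
  proof (rule dependent_nat_choice)
    show "\<exists>R. iso R" by (rule exI[of _ "{}"]) (simp add: iso_def)
    fix R n assume R: "iso R"
    obtain R' where R': "iso R'" "R \<subseteq> R'" "p n \<in> fst ` R'"
      using forw[OF R, of "p n"] p by blast
    obtain R'' where R'': "iso R''" "R' \<subseteq> R''" "q n \<in> snd ` R''"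
      using backw[OF R'(1), of "q n"] q by blast
    show "\<exists>R''. iso R'' \<and> R \<subseteq> R'' \<and> p n \<in> fst ` R'' \<and> q n \<in> snd ` R''"
      using R' R'' by (intro exI[of _ R'']) auto
  qed
  then obtain R where R: "\<And>n. iso (R n)" "\<And>n. R n \<subseteq> R (Suc n)"
      "\<And>n. p n \<in> fst ` R (Suc n)" "\<And>n. q n \<in> snd ` R (Suc n)" by metis
  have mono: "m \<le> n \<Longrightarrow> R m \<subseteq> R n" for m n
    using lift_Suc_mono_le[of R, OF R(2)] by blast
  define T where "T = (\<Union>n. R n)"
  have TPQ: "T \<subseteq> P \<times> Q" using R(1) by (auto simp: T_def iso_def)
  have Tiso: "d a a' = e b b'" if ab: "(a, b) \<in> T" "(a', b') \<in> T" for a b a' b'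
  proof -
    from ab obtain m n where "(a, b) \<in> R m" "(a', b') \<in> R n" by (auto simp: T_def)
    then have "(a, b) \<in> R (max m n)" "(a', b') \<in> R (max m n)"
      using mono[of m "max m n"] mono[of n "max m n"] by auto
    then show ?thesis using R(1)[of "max m n"] by (auto simp: iso_def)
  qed
  have TP: "\<exists>y. (x, y) \<in> T" if x: "x \<in> P" for x
  proof -
    obtain n where "x = p n" using p x by auto
    then show ?thesis using R(3)[of n] by (force simp: T_def)
  qed
  have TQ: "\<exists>x. (x, y) \<in> T" if y: "y \<in> Q" for y
  proof -
    obtain n where "y = q n" using q y by auto
    then show ?thesis using R(4)[of n] by (force simp: T_def)
  qed
  obtain f where f: "\<And>x. x \<in> P \<Longrightarrow> (x, f x) \<in> T" using TP by metis
  have fiso: "isometric_on P d e f" using Tiso[OF f f] by (simp add: isometric_on_def)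
  have "inj_on f P"
  proof (rule inj_onI)
    fix x x' assume x: "x \<in> P" "x' \<in> P" "f x = f x'"
    have "f x' \<in> Q" using f[OF x(2)] TPQ by auto
    moreover have "e (f x) (f x') = d x x'" using fiso x(1,2) by (simp add: isometric_on_def)
    ultimately show "x = x'" using x by simp
  qed
  moreover have "f ` P = Q"
  proof
    show "f ` P \<subseteq> Q" using f TPQ by auto
    show "Q \<subseteq> f ` P"
    proof
      fix y assume y: "y \<in> Q"
      obtain x where x: "(x, y) \<in> T" using TQ[OF y] by blast
      then have xP: "x \<in> P" using TPQ by auto
      have "f x \<in> Q" using f[OF xP] TPQ by auto
      \<comment> \<open>\<open>T\<close> relates \<open>x\<close> to both \<open>f x\<close> and
        \<open>y\<close>, so these are at distance \<open>d x x\<close>.\<close>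
      then have "e (f x) y = 0" using Tiso[OF f[OF xP] x] xP by simp
      then have "f x = y" using \<open>f x \<in> Q\<close> y by simp
      then show "y \<in> f ` P" using xP by blast
    qed
  qed
  ultimately show thesis using that fiso by (simp add: bij_betw_def)
qed

section \<open>Displacement functions of single cycles\<close>

lemma carrier_isometry_group:
  "f \<in> carrier (isometry_group M d) \<longleftrightarrow>
    f \<in> extensional M \<and> bij_betw f M M \<and> isometric_on M d d f"
  by (auto simp: isometry_group_def Bij_def)

lemma carrier_isometry_group_mem: "f \<in> carrier (isometry_group M d) \<Longrightarrow> x \<in> M \<Longrightarrow> f x \<in> M"
  by (auto simp: carrier_isometry_group bij_betw_def)

lemma carrier_isometry_group_dist:
  "f \<in> carrier (isometry_group M d) \<Longrightarrow> x \<in> M \<Longrightarrow> y \<in> M \<Longrightarrow> d (f x) (f y) = d x y"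
  by (auto simp: carrier_isometry_group isometric_on_def)

lemma mult_isometry_group:
  "f \<in> carrier (isometry_group M d) \<Longrightarrow> g \<in> carrier (isometry_group M d) \<Longrightarrow>
    f \<otimes>\<^bsub>isometry_group M d\<^esub> g = compose M f g"
  by (simp add: isometry_group_def BijGroup_def)

lemma mult_isometry_group_apply:
  "f \<in> carrier (isometry_group M d) \<Longrightarrow> g \<in> carrier (isometry_group M d) \<Longrightarrow> x \<in> M \<Longrightarrow>
    (f \<otimes>\<^bsub>isometry_group M d\<^esub> g) x = f (g x)"
  by (simp add: mult_isometry_group compose_def)

lemma one_isometry_group_apply: "x \<in> M \<Longrightarrow> \<one>\<^bsub>isometry_group M d\<^esub> x = x"
  by (simp add: isometry_group_def BijGroup_def)

lemma inv_isometry_group_apply: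
  assumes "f \<in> carrier (isometry_group M d)" "x \<in> M"
  shows "(inv\<^bsub>isometry_group M d\<^esub> f) (f x) = x"
proof -
  interpret group "isometry_group M d" by (rule group_isometry_group)
  show ?thesis
    using mult_isometry_group_apply[OF inv_closed[OF assms(1)] assms]
      l_inv[OF assms(1)] one_isometry_group_apply[OF assms(2)] by metis
qed

lemma funpow_mem: "g \<in> carrier (isometry_group M d) \<Longrightarrow> x \<in> M \<Longrightarrow> (g ^^ n) x \<in> M"
  by (induction n) (auto intro: carrier_isometry_group_mem)

lemma funpow_dist:
  "g \<in> carrier (isometry_group M d) \<Longrightarrow> x \<in> M \<Longrightarrow> y \<in> M \<Longrightarrow> d ((g ^^ n) x) ((g ^^ n) y) = d x y"
  by (induction n) (auto simp: funpow_mem carrier_isometry_group_dist)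

lemma pow_isometry_group_apply:
  assumes "g \<in> carrier (isometry_group M d)" "x \<in> M"
  shows "(g [^]\<^bsub>isometry_group M d\<^esub> n) x = (g ^^ n) x"
proof -
  interpret group "isometry_group M d" by (rule group_isometry_group)
  show ?thesis
    using assms(2)
  proof (induction n arbitrary: x)
    case 0
    then show ?case by (simp add: one_isometry_group_apply)
  next
    case (Suc n)
    then show ?case
      using assms(1) mult_isometry_group_apply[OF nat_pow_closed assms(1) Suc.prems]
      by (simp add: carrier_isometry_group_mem funpow_swap1)
  qed
qed

section \<open>Parametrized cycles and their displacement\<close>

definition cycle_param :: "'a set \<Rightarrow> ('a \<Rightarrow> 'a) \<Rightarrow> (int \<Rightarrow> 'a) \<Rightarrow> bool" where
  "cycle_param M g f \<longleftrightarrow> range f = M \<and> (\<forall>k. g (f k) = f (k + 1))"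

text \<open>A complete conjugacy invariant for single cycles. Natural exponents suffice, since
  inverse powers displace by the same amounts.\<close>

definition displacement :: "'a set \<Rightarrow> ('a \<Rightarrow> 'a \<Rightarrow> real) \<Rightarrow> ('a \<Rightarrow> 'a) \<Rightarrow> (nat \<Rightarrow> real) \<Rightarrow> bool" where
  "displacement M d g \<phi> \<longleftrightarrow> (\<forall>x\<in>M. \<forall>n. d x ((g ^^ n) x) = \<phi> n)"

lemma cycle_param_mem: "cycle_param M g f \<Longrightarrow> f k \<in> M"
  by (auto simp: cycle_param_def)

lemma cycle_param_funpow: "cycle_param M g f \<Longrightarrow> (g ^^ n) (f k) = f (k + int n)"
  by (induction n) (auto simp: cycle_param_def ac_simps)

text \<open>Powers of \<open>g\<close> shift the parameter isometrically. With nonnegative powers,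
  \<open>(0, j - i)\<close> is moved to \<open>(i, j)\<close>, or for negative \<open>i\<close> the
  latter to the former.\<close>

lemma cycle_param_dist:
  assumes g: "g \<in> carrier (isometry_group M d)" and f: "cycle_param M g f"
  shows "d (f i) (f j) = d (f 0) (f (j - i))"
proof -
  have shift: "d (f (i + int n)) (f (j + int n)) = d (f i) (f j)" for i j n
    using funpow_dist[OF g cycle_param_mem[OF f] cycle_param_mem[OF f], of n i j]
    by (simp add: cycle_param_funpow[OF f])
  show ?thesis
    using shift[of 0 "nat i" "j - i"] shift[of i "nat (- i)" j] by (cases "0 \<le> i") auto
qed

lemma cycle_param_displacement:
  assumes "g \<in> carrier (isometry_group M d)" "cycle_param M g f"
  shows "displacement M d g (\<lambda>n. d (f 0) (f (int n)))"
  unfolding displacement_def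
proof (intro ballI allI)
  fix x n assume "x \<in> M"
  then obtain k where x: "x = f k" using assms(2) by (auto simp: cycle_param_def)
  show "d x ((g ^^ n) x) = d (f 0) (f (int n))"
    using cycle_param_dist[OF assms, of k "k + int n"] by (simp add: x cycle_param_funpow[OF assms(2)])
qed

lemma single_cycle_param:
  assumes g: "g \<in> carrier (isometry_group M d)" and cyc: "single_cycle M d g" and ne: "M \<noteq> {}"
  obtains f where "cycle_param M g f"
proof -
  interpret group "isometry_group M d" by (rule group_isometry_group)
  obtain x where x: "x \<in> M" using ne by blast
  define f where "f k = (g [^]\<^bsub>isometry_group M d\<^esub> (k :: int)) x" for k
  have "range f = M"
  proof
    show "range f \<subseteq> M"
      using carrier_isometry_group_mem[OF int_pow_closed[OF g] x] by (auto simp: f_def)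
    show "M \<subseteq> range f"
    proof
      fix y assume "y \<in> M"
      then obtain h where "h \<in> generate (isometry_group M d) {g}" "h x = y"
        using cyc x by (auto simp: single_cycle_def)
      then show "y \<in> range f" by (auto simp: generate_pow[OF g] f_def)
    qed
  qed
  moreover have "g (f k) = f (k + 1)" for k
    using mult_isometry_group_apply[OF g int_pow_closed[OF g] x, of k] int_pow_mult[OF g, of 1 k] g
    by (simp add: f_def add.commute)
  ultimately have "cycle_param M g f" by (simp add: cycle_param_def)
  then show thesis by (rule that)
qed

lemma cycle_param_single_cycle:
  assumes g: "g \<in> carrier (isometry_group M d)" and f: "cycle_param M g f"
  shows "single_cycle M d g"
proof -
  interpret group "isometry_group M d" by (rule group_isometry_group)
  have pow: "(g [^]\<^bsub>isometry_group M d\<^esub> n) (f i) = f (i + int n)" for n :: nat and i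
    using pow_isometry_group_apply[OF g cycle_param_mem[OF f]] cycle_param_funpow[OF f] by metis
  have zpow: "(g [^]\<^bsub>isometry_group M d\<^esub> (k :: int)) (f i) = f (i + k)" for k i
  proof (cases k rule: int_cases2)
    case (nonneg n)
    then show ?thesis using pow[of n i] by (simp only: int_pow_int)
  next
    case (nonpos n)
    have "(inv\<^bsub>isometry_group M d\<^esub> (g [^]\<^bsub>isometry_group M d\<^esub> n)) (f (i - int n + int n)) = f (i - int n)"
      using inv_isometry_group_apply[OF nat_pow_closed[OF g] cycle_param_mem[OF f]] pow by metis
    then show ?thesis using nonpos by (simp add: int_pow_neg_int[OF g])
  qed
  show ?thesis
    unfolding single_cycle_def
  proof (intro ballI)
    fix x y assume "x \<in> M" "y \<in> M"
    then obtain i j where "x = f i" "y = f j" using f by (auto simp: cycle_param_def)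
    then have "(g [^]\<^bsub>isometry_group M d\<^esub> (j - i)) x = y" using zpow by simp
    moreover have "g [^]\<^bsub>isometry_group M d\<^esub> (j - i) \<in> generate (isometry_group M d) {g}"
      unfolding generate_pow[OF g] by (rule CollectI, rule exI[of _ "j - i"]) simp
    ultimately show "\<exists>h\<in>generate (isometry_group M d) {g}. h x = y" by (rule bexI)
  qed
qed

section \<open>Conjugation and displacement\<close>

lemma conjugacy_class_intertwines:
  assumes g: "g \<in> carrier (isometry_group M d)" and h: "h \<in> conjugacy_class (isometry_group M d) g"
  obtains F where "F \<in> carrier (isometry_group M d)" "h \<in> carrier (isometry_group M d)"
    "\<And>x. x \<in> M \<Longrightarrow> h (F x) = F (g x)"
proof -
  interpret group "isometry_group M d" by (rule group_isometry_group)
  obtain F where F: "F \<in> carrier (isometry_group M d)"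
    and hF: "h = F \<otimes>\<^bsub>isometry_group M d\<^esub> g \<otimes>\<^bsub>isometry_group M d\<^esub> inv\<^bsub>isometry_group M d\<^esub> F"
    using h by (auto simp: conjugacy_class_def)
  have hc: "h \<in> carrier (isometry_group M d)" using F g by (simp add: hF)
  have "h (F x) = F (g x)" if x: "x \<in> M" for x
    unfolding hF using F g x
    by (simp add: mult_isometry_group_apply inv_isometry_group_apply carrier_isometry_group_mem)
  then show thesis using that F hc by blast
qed

text \<open>Multiplying the intertwining relation by the inverse of \<open>F\<close> gives
  conjugacy; the relation itself can be checked point by point.\<close>

lemma intertwines_conjugacy_class:
  assumes F: "F \<in> carrier (isometry_group M d)" and g: "g \<in> carrier (isometry_group M d)"
    and h: "h \<in> carrier (isometry_group M d)" and eq: "\<And>x. x \<in> M \<Longrightarrow> h (F x) = F (g x)"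
  shows "h \<in> conjugacy_class (isometry_group M d) g"
proof -
  interpret group "isometry_group M d" by (rule group_isometry_group)
  have "h \<otimes>\<^bsub>isometry_group M d\<^esub> F = F \<otimes>\<^bsub>isometry_group M d\<^esub> g"
    using F g h eq by (auto simp: mult_isometry_group compose_def fun_eq_iff)
  then have "h = F \<otimes>\<^bsub>isometry_group M d\<^esub> g \<otimes>\<^bsub>isometry_group M d\<^esub> inv\<^bsub>isometry_group M d\<^esub> F"
    using F g h by (metis inv_solve_right m_closed)
  then show ?thesis using F by (auto simp: conjugacy_class_def)
qed

lemma (in group) conjugacy_class_eq:
  assumes g: "g \<in> carrier G" and h: "h \<in> conjugacy_class G g"
  shows "conjugacy_class G h = conjugacy_class G g"
proof -
  have sub: "conjugacy_class G (x \<otimes> a \<otimes> inv x) \<subseteq> conjugacy_class G a"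
    if "x \<in> carrier G" "a \<in> carrier G" for x a
  proof
    fix b assume "b \<in> conjugacy_class G (x \<otimes> a \<otimes> inv x)"
    then obtain y where y: "y \<in> carrier G" "b = y \<otimes> (x \<otimes> a \<otimes> inv x) \<otimes> inv y"
      by (auto simp: conjugacy_class_def)
    then have "b = (y \<otimes> x) \<otimes> a \<otimes> inv (y \<otimes> x)"
      using that by (simp add: m_assoc inv_mult_group)
    then show "b \<in> conjugacy_class G a"
      using that y by (auto simp: conjugacy_class_def)
  qed
  obtain x where x: "x \<in> carrier G" "h = x \<otimes> g \<otimes> inv x"
    using h by (auto simp: conjugacy_class_def)
  have "inv x \<otimes> h \<otimes> inv (inv x) = g"
    using x g by (simp add: m_assoc) (simp flip: m_assoc)
  then show ?thesis
    using sub[of x g] sub[of "inv x" h] x g by auto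
qed

lemma (in group) conjugacy_class_self: "g \<in> carrier G \<Longrightarrow> g \<in> conjugacy_class G g"
  unfolding conjugacy_class_def by (rule CollectI, rule exI[of _ \<one>]) simp

text \<open>The conjugator carries the \<open>g\<close>-orbit of \<open>x\<close> isometrically to
  the \<open>h\<close>-orbit of its image, and it is onto.\<close>

lemma displacement_conjugate:
  assumes g: "g \<in> carrier (isometry_group M d)" and \<phi>: "displacement M d g \<phi>"
    and h: "h \<in> conjugacy_class (isometry_group M d) g"
  shows "displacement M d h \<phi>"
proof -
  obtain F where F: "F \<in> carrier (isometry_group M d)" "\<And>x. x \<in> M \<Longrightarrow> h (F x) = F (g x)"
    using conjugacy_class_intertwines[OF g h] by blast
  have pow: "(h ^^ n) (F x) = F ((g ^^ n) x)" if "x \<in> M" for n x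
    using that by (induction n) (auto simp: F(2) funpow_mem[OF g])
  show ?thesis
    unfolding displacement_def
  proof (intro ballI allI)
    fix y n assume "y \<in> M"
    then obtain x where x: "x \<in> M" "y = F x"
      using F(1) by (auto simp: carrier_isometry_group bij_betw_def)
    show "d y ((h ^^ n) y) = \<phi> n"
      using \<phi> x pow[OF x(1)] carrier_isometry_group_dist[OF F(1) x(1) funpow_mem[OF g x(1)]]
      by (simp add: displacement_def)
  qed
qed

lemma displacement_unique:
  "displacement M d g \<phi> \<Longrightarrow> displacement M d g \<psi> \<Longrightarrow> M \<noteq> {} \<Longrightarrow> \<phi> = \<psi>"
  unfolding displacement_def by (metis ext ex_in_conv)

lemma single_cycle_displacement:
  assumes "g \<in> carrier (isometry_group M d)" "single_cycle M d g" "M \<noteq> {}"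
  obtains \<phi> where "displacement M d g \<phi>"
  using single_cycle_param[OF assms] cycle_param_displacement[OF assms(1)] by metis

text \<open>The displacement determines all distances along a cycle, so sending \<open>a k\<close>
  to \<open>b k\<close> is an isometry, and it intertwines \<open>g\<close> and
  \<open>h\<close>.\<close>

lemma single_cycle_conjugate:
  assumes "Metric_space M d" and ne: "M \<noteq> {}"
    and g: "g \<in> carrier (isometry_group M d)" "single_cycle M d g" "displacement M d g \<phi>"
    and h: "h \<in> carrier (isometry_group M d)" "single_cycle M d h" "displacement M d h \<phi>"
  shows "h \<in> conjugacy_class (isometry_group M d) g"
proof -
  interpret Metric_space M d by fact
  obtain a where a: "cycle_param M g a" using single_cycle_param[OF g(1,2) ne] .
  obtain b where b: "cycle_param M h b" using single_cycle_param[OF h(1,2) ne] .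
  have ab: "d (a i) (a j) = d (b i) (b j)" for i j
  proof -
    have le: "d (a i) (a j) = d (b i) (b j)" if "i \<le> j" for i j
    proof -
      have "d (a 0) (a (int n)) = d (b 0) (b (int n))" for n
        using displacement_unique[OF cycle_param_displacement[OF g(1) a] g(3) ne]
          displacement_unique[OF cycle_param_displacement[OF h(1) b] h(3) ne]
        by (simp add: fun_eq_iff)
      from this[of "nat (j - i)"] show ?thesis
        using that cycle_param_dist[OF g(1) a, of i j] cycle_param_dist[OF h(1) b, of i j] by simp
    qed
    show ?thesis using le[of i j] le[of j i] commute by (cases "i \<le> j") auto
  qed
  \<comment> \<open>A parametrization may repeat points; the choice of \<open>k\<close> does not
    matter, because \<open>a i = a k\<close> forces \<open>b i = b k\<close> by
    \<open>ab\<close>.\<close>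
  define F where "F = (\<lambda>x\<in>M. b (SOME k. a k = x))"
  have F: "F (a k) = b k" for k
  proof -
    have "a (SOME i. a i = a k) = a k" by (rule someI[of _ k]) simp
    then have "d (b (SOME i. a i = a k)) (b k) = 0"
      using ab[of "SOME i. a i = a k" k] cycle_param_mem[OF a] by simp
    then show ?thesis using cycle_param_mem[OF a] cycle_param_mem[OF b] by (simp add: F_def)
  qed
  have M: "M = range a" "M = range b" using a b by (auto simp: cycle_param_def)
  have iso: "isometric_on M d d F"
    unfolding isometric_on_def using M(1) F ab by auto
  then have "inj_on F M"
    using M F cycle_param_mem[OF a] cycle_param_mem[OF b]
    unfolding isometric_on_def inj_on_def by (metis rangeE zero)
  moreover have "F ` M = M"
  proof -
    have "F ` range a = range b" using F by (auto simp: image_iff)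
    then show ?thesis using M by metis
  qed
  ultimately have "F \<in> carrier (isometry_group M d)"
    using iso by (simp add: carrier_isometry_group bij_betw_def F_def)
  moreover have "h (F x) = F (g x)" if x: "x \<in> M" for x
  proof -
    obtain k where "x = a k" using x M(1) by auto
    then show ?thesis using a b F by (simp add: cycle_param_def)
  qed
  ultimately show ?thesis using intertwines_conjugacy_class g(1) h(1) by metis
qed

text \<open>Since \<open>G ^^ n\<close> is an isometry, replacing \<open>x\<close> by a point
  \<open>q\<close> of \<open>Q\<close> changes the displacement by at most
  \<open>2 * d x q\<close>.\<close>

lemma displacement_dense:
  assumes "Metric_space U d" "Q \<subseteq> U" and dense: "Metric_space.mtopology U d closure_of Q = U"
    and G: "G \<in> carrier (isometry_group U d)" and Gg: "\<And>x. x \<in> Q \<Longrightarrow> G x = g x"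
    and g: "g \<in> carrier (isometry_group Q d)" and \<phi>: "displacement Q d g \<phi>"
  shows "displacement U d G \<phi>"
  unfolding displacement_def
proof (intro ballI allI)
  interpret Metric_space U d by fact
  fix x n assume x: "x \<in> U"
  have near: "\<exists>q\<in>Q. d x q < r" if "r > 0" for r
    using that x dense by (auto simp: metric_closure_of)
  have near': "\<exists>q\<in>Q. 2 * d x q < r" if "r > 0" for r
    using near[of "r / 2"] that by (auto simp: mult.commute)
  let ?y = "(G ^^ n) x"
  have y: "?y \<in> U" by (rule funpow_mem[OF G x])
  show "d x ?y = \<phi> n"
  proof (rule ccontr)
    assume "d x ?y \<noteq> \<phi> n"
    then have "\<bar>d x ?y - \<phi> n\<bar> > 0" by simp
    then obtain q where q: "q \<in> Q" "2 * d x q < \<bar>d x ?y - \<phi> n\<bar>"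
      using near' by blast
    have qU: "q \<in> U" using q assms(2) by auto
    have "(G ^^ n) q = (g ^^ n) q"
      by (induction n) (auto simp: Gg funpow_mem[OF g q(1)])
    then have "d q ((G ^^ n) q) = \<phi> n" using \<phi> q(1) by (simp add: displacement_def)
    moreover have "d ?y ((G ^^ n) q) = d x q" by (rule funpow_dist[OF G x qU])
    moreover have z: "(G ^^ n) q \<in> U" by (rule funpow_mem[OF G qU])
    ultimately have "\<bar>d x ?y - \<phi> n\<bar> \<le> 2 * d x q"
      using triangle[OF x qU y] triangle[OF qU z y] triangle[OF qU x z] triangle[OF x y z]
        commute[of x q] commute[of ?y "(G ^^ n) q"] by linarith
    with q(2) show False by simp
  qed
qed

section \<open>Counting the classes of single cycles\<close>

lemma single_cycle_of_translation_invariant: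
  assumes f: "bij_betw f (UNIV :: int set) M" and d: "\<And>i j. d (f i) (f j) = \<phi> (i - j)"
  obtains g where "g \<in> carrier (isometry_group M d)" "single_cycle M d g"
    "displacement M d g (\<lambda>n. \<phi> (- int n))"
proof -
  \<comment> \<open>The shift by 1 carried over to \<open>M\<close>. Its displacement
    \<open>d (f 0) (f n)\<close> is \<open>\<phi> (0 - n)\<close>, hence the sign in the
    conclusion.\<close>
  define g where "g = (\<lambda>x\<in>M. f (inv_into UNIV f x + 1))"
  have inj: "inj f" and M: "M = range f" using f by (auto simp: bij_betw_def)
  have gf: "g (f k) = f (k + 1)" for k using inj by (simp add: g_def M)
  have "inj_on g M" using gf by (auto simp: M inj_on_def dest!: injD[OF inj])
  moreover have "g ` M = M"
  proof -
    have "f k \<in> g ` M" for k using gf[of "k - 1"] M by (intro image_eqI[of _ _ "f (k - 1)"]) auto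
    then show ?thesis using gf M by auto
  qed
  moreover have "isometric_on M d d g" using gf d by (auto simp: M isometric_on_def)
  ultimately have carrier: "g \<in> carrier (isometry_group M d)"
    by (simp add: carrier_isometry_group bij_betw_def g_def)
  have param: "cycle_param M g f" using gf M by (simp add: cycle_param_def)
  show thesis
    by (rule that[OF carrier cycle_param_single_cycle[OF carrier param]])
      (use cycle_param_displacement[OF carrier param] d in simp)
qed

text \<open>A class is determined by its displacement function; as the values are rational, the
  graph of that function is coded by a set of naturals.\<close>

lemma single_cycle_classes_lepoll:
  assumes Q: "rational_urysohn_space Q d"
  shows "single_cycle_classes Q d \<lesssim> (UNIV :: nat set set)"
proof -
  interpret group "isometry_group Q d" by (rule group_isometry_group)
  have metric: "Metric_space Q d" using Q by (simp add: rational_urysohn_space_def)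
  have ne: "Q \<noteq> {}" by (rule rational_urysohn_nonempty[OF Q])
  have "\<exists>g \<phi>. g \<in> carrier (isometry_group Q d) \<and> single_cycle Q d g \<and> displacement Q d g \<phi> \<and>
      C = conjugacy_class (isometry_group Q d) g" if "C \<in> single_cycle_classes Q d" for C
    using that single_cycle_displacement[OF _ _ ne] unfolding single_cycle_classes_def by blast
  then obtain \<gamma> \<Phi> where \<gamma>: "\<And>C. C \<in> single_cycle_classes Q d \<Longrightarrow> \<gamma> C \<in> carrier (isometry_group Q d) \<and>
      single_cycle Q d (\<gamma> C) \<and> displacement Q d (\<gamma> C) (\<Phi> C) \<and>
      C = conjugacy_class (isometry_group Q d) (\<gamma> C)"
    by metis
  define code where "code C = {to_nat (n, q) | n q. \<Phi> C n = real_of_rat q}" for C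
  have "inj_on code (single_cycle_classes Q d)"
  proof (rule inj_onI)
    fix C D assume C: "C \<in> single_cycle_classes Q d" and D: "D \<in> single_cycle_classes Q d"
      and eq: "code C = code D"
    have "\<Phi> C n = \<Phi> D n" for n
    proof -
      obtain x where x: "x \<in> Q" using ne by blast
      have "\<Phi> C n = d x ((\<gamma> C ^^ n) x)" using \<gamma>[OF C] x by (simp add: displacement_def)
      also have "\<dots> \<in> \<rat>"
        using Q x funpow_mem[of "\<gamma> C" Q d x n] \<gamma>[OF C] by (simp add: rational_urysohn_space_def)
      finally obtain q where q: "\<Phi> C n = real_of_rat q" by (auto simp: Rats_def)
      then have "to_nat (n, q) \<in> code C" by (auto simp: code_def)
      then have "to_nat (n, q) \<in> code D" using eq by simp
      then show ?thesis using q by (auto simp: code_def)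
    qed
    then have "\<Phi> C = \<Phi> D" by (rule ext)
    then have "\<gamma> D \<in> conjugacy_class (isometry_group Q d) (\<gamma> C)"
      using single_cycle_conjugate[OF metric ne] \<gamma>[OF C] \<gamma>[OF D] by metis
    then show "C = D" using conjugacy_class_eq \<gamma>[OF C] \<gamma>[OF D] by metis
  qed
  then show ?thesis unfolding lepoll_def by auto
qed

text \<open>For each \<open>S\<close>, uniqueness of the rational Urysohn space transports the shift
  on the integers to \<open>Q\<close>. The displacement recovers \<open>limit_norm S\<close> and
  hence \<open>S\<close>.\<close>

lemma nat_set_set_lepoll_single_cycle_classes:
  assumes Q: "rational_urysohn_space Q d"
  shows "(UNIV :: nat set set) \<lesssim> single_cycle_classes Q d"
proof -
  interpret group "isometry_group Q d" by (rule group_isometry_group)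
  have ne: "Q \<noteq> {}" by (rule rational_urysohn_nonempty[OF Q])
  have "\<exists>g. g \<in> carrier (isometry_group Q d) \<and> single_cycle Q d g \<and>
      displacement Q d g (\<lambda>n. real_of_rat (limit_norm S (- int n)))" for S
  proof -
    obtain f where f: "bij_betw f UNIV Q"
        "isometric_on UNIV (\<lambda>m n. real_of_rat (limit_norm S (m - n))) d f"
      using rational_urysohn_unique[OF rational_urysohn_space_limit_norm Q] .
    then have "d (f i) (f j) = real_of_rat (limit_norm S (i - j))" for i j
      by (simp add: isometric_on_def)
    from single_cycle_of_translation_invariant[OF f(1), of d, OF this] show ?thesis by metis
  qed
  then obtain \<gamma> where \<gamma>: "\<And>S. \<gamma> S \<in> carrier (isometry_group Q d)" "\<And>S. single_cycle Q d (\<gamma> S)"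
      "\<And>S. displacement Q d (\<gamma> S) (\<lambda>n. real_of_rat (limit_norm S (- int n)))"
    by metis
  define cls where "cls S = conjugacy_class (isometry_group Q d) (\<gamma> S)" for S
  have "inj cls"
  proof (rule injI)
    fix S T assume "cls S = cls T"
    then have "\<gamma> T \<in> conjugacy_class (isometry_group Q d) (\<gamma> S)"
      using conjugacy_class_self[OF \<gamma>(1)] by (simp add: cls_def)
    then have "displacement Q d (\<gamma> T) (\<lambda>n. real_of_rat (limit_norm S (- int n)))"
      by (rule displacement_conjugate[OF \<gamma>(1,3)])
    from displacement_unique[OF this \<gamma>(3) ne]
    have nat: "limit_norm S (int n) = limit_norm T (int n)" for n
      by (simp add: fun_eq_iff limit_norm_minus)
    have "limit_norm S k = limit_norm T k" for k
      using nat by (cases k rule: int_cases2) (auto simp: limit_norm_minus)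
    then show "S = T" using inj_limit_norm by (auto dest: injD)
  qed
  moreover have "range cls \<subseteq> single_cycle_classes Q d"
    using \<gamma>(1,2) by (auto simp: cls_def single_cycle_classes_def)
  ultimately show ?thesis unfolding lepoll_def by auto
qed

theorem corollary12:
  fixes U Q :: "'a set" and d :: "'a \<Rightarrow> 'a \<Rightarrow> real"
  assumes "urysohn_space U d"
    and "rational_urysohn_space Q d"
    and "Q \<subseteq> U" and "Metric_space.mtopology U d closure_of Q = U"
  shows "single_cycle_classes Q d \<approx> (UNIV :: nat set set) \<and>
    (\<forall>C\<in>single_cycle_classes Q d. \<forall>D\<in>single_cycle_classes Q d. C \<noteq> D \<longrightarrow>
      (\<forall>g\<in>C. \<forall>h\<in>D. isometry_extension U Q d h \<notin>
        conjugacy_class (isometry_group U d) (isometry_extension U Q d g)))"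
proof (intro conjI ballI impI notI)
  show "single_cycle_classes Q d \<approx> (UNIV :: nat set set)"
    using single_cycle_classes_lepoll[OF assms(2)] nat_set_set_lepoll_single_cycle_classes[OF assms(2)]
    by (rule lepoll_antisym)
next
  interpret group "isometry_group Q d" by (rule group_isometry_group)
  have U: "Metric_space U d" "Metric_space.mcomplete U d"
    using assms(1) by (simp_all add: urysohn_space_def)
  have metric: "Metric_space Q d" using assms(2) by (simp add: rational_urysohn_space_def)
  have ne: "Q \<noteq> {}" by (rule rational_urysohn_nonempty[OF assms(2)])
  \<comment> \<open>By density the extension keeps the displacement function.\<close>
  have ext: "isometry_extension U Q d g \<in> carrier (isometry_group U d)"
      "displacement U d (isometry_extension U Q d g) \<phi>"
    if g: "g \<in> carrier (isometry_group Q d)" "displacement Q d g \<phi>" for g \<phi>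
  proof -
    have *: "isometry_extension U Q d g \<in> carrier (isometry_group U d) \<and>
        (\<forall>x\<in>Q. isometry_extension U Q d g x = g x)"
      unfolding isometry_extension_def
      by (rule theI'[OF ex1_isometry_extension[OF U assms(3,4) g(1)]])
    then show "isometry_extension U Q d g \<in> carrier (isometry_group U d)" by blast
    show "displacement U d (isometry_extension U Q d g) \<phi>"
      by (rule displacement_dense[OF U(1) assms(3,4) _ _ g]) (use * in auto)
  qed
  fix C D g h
  assume C: "C \<in> single_cycle_classes Q d" and D: "D \<in> single_cycle_classes Q d" and "C \<noteq> D"
    and g: "g \<in> C" and h: "h \<in> D"
    and conj: "isometry_extension U Q d h \<in>
      conjugacy_class (isometry_group U d) (isometry_extension U Q d g)"
  obtain g0 where g0: "g0 \<in> carrier (isometry_group Q d)" "single_cycle Q d g0"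
      "C = conjugacy_class (isometry_group Q d) g0"
    using C by (auto simp: single_cycle_classes_def)
  obtain h0 where h0: "h0 \<in> carrier (isometry_group Q d)" "single_cycle Q d h0"
      "D = conjugacy_class (isometry_group Q d) h0"
    using D by (auto simp: single_cycle_classes_def)
  obtain \<phi> where \<phi>: "displacement Q d g0 \<phi>" using single_cycle_displacement[OF g0(1,2) ne] .
  obtain \<psi> where \<psi>: "displacement Q d h0 \<psi>" using single_cycle_displacement[OF h0(1,2) ne] .
  have gc: "g \<in> carrier (isometry_group Q d)"
    using conjugacy_class_intertwines[OF g0(1)] g g0(3) by blast
  have hc: "h \<in> carrier (isometry_group Q d)"
    using conjugacy_class_intertwines[OF h0(1)] h h0(3) by blast
  have dg: "displacement Q d g \<phi>" using displacement_conjugate[OF g0(1) \<phi>] g g0(3) by blast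
  have dh: "displacement Q d h \<psi>" using displacement_conjugate[OF h0(1) \<psi>] h h0(3) by blast
  \<comment> \<open>Conjugacy in the larger group equates the two displacement functions, and these
    already decide conjugacy in the smaller group.\<close>
  have "displacement U d (isometry_extension U Q d h) \<phi>"
    by (rule displacement_conjugate[OF ext[OF gc dg] conj])
  then have "\<phi> = \<psi>"
    using displacement_unique[OF _ ext(2)[OF hc dh]] ne assms(3) by blast
  then have "h0 \<in> conjugacy_class (isometry_group Q d) g0"
    using single_cycle_conjugate[OF metric ne g0(1,2) \<phi> h0(1,2)] \<psi> by blast
  then show False using conjugacy_class_eq[OF g0(1)] g0(3) h0(3) \<open>C \<noteq> D\<close> by blast
qed

end
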